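(* Let $\Pi$ and $\Pi'$ be polar spaces of ranks $n$ and $n'$ respectively, with $n\le n'$, and let $f:{\mathcal G}_{n-1}(\Pi)\to {\mathcal G}_{n'-1}(\Pi')$ be an isometric embedding of $\Gamma_{n-1}(\Pi)$ in $\Gamma_{n'-1}(\Pi')$. Then there exists an $(n'-n-1)$-dimensional singular subspace $M$ of $\Pi'$ such that the image of $f$ is contained in $[M\rangle_{n'-1}$ and $f$ is induced by a frames preserving mapping $g$ of $\Pi$ to the polar space $[M\rangle_{n'-n}$, i.e. for every $S\in{\mathcal G}_{n-1}(\Pi)$, $f(S)$ is the maximal singular subspace of $\Pi'$ spanned by the subspaces $g(p)$, $p\in S$.
   Context: A polar space is a partial linear space $\Pi=(P,\mathcal L)$ (points and lines, two distinct collinear points on a unique line) in which every line has at least three points, no point is collinear with all points, each point is collinear with exactly one or all points of any line, and every flag of singular subspaces (subspaces in which any two points are collinear) is finite. Write $p\perp q$ for collinearity. Dimensions of singular subspaces are projective dimensions (empty set: $-1$, point: $0$). The rank $n$ means all maximal singular subspaces are projective spaces of dimension $n-1\ge 2$. ${\mathcal G}_{k}(\Pi)$ is the set of $k$-dimensional singular subspaces of $\Pi$; $\Gamma_{n-1}(\Pi)$ is the graph on ${\mathcal G}_{n-1}(\Pi)$ where two maximal singular subspaces are adjacent iff their intersection is $(n-2)$-dimensional (similarly $\Gamma_{n'-1}(\Pi')$). For a singular subspace $M$ of $\Pi'$ and $k>\dim M$, $[M\rangle_k$ is the set of $k$-dimensional singular subspaces of $\Pi'$ containing $M$. For $M$ of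 dimension $n'-n-1$, $[M\rangle_{n'-n}$ is a polar space of rank $n$ whose points are the elements of $[M\rangle_{n'-n}$ and whose lines are the sets of all elements of $[M\rangle_{n'-n}$ contained in some fixed element of $[M\rangle_{n'-n+1}$ (if $M=\emptyset$, i.e. $n=n'$, this is $\Pi'$ itself). A frame of a rank $n$ polar space is a set of $2n$ points $\{p_1,\dots,p_{2n}\}$ such that for each $i$ there is a unique $\sigma(i)$ with $p_i\not\perp p_{\sigma(i)}$. A frames preserving mapping between polar spaces of the same rank is a map on points sending every frame to a frame. An isometric embedding of graphs is an injection on vertices preserving graph distance. *)

theory Defs
  imports Main "HOL-Library.Extended_Nat" "HOL-Library.FuncSet"
begin

record 'a point_line =
  points :: "'a set"
  lines :: "'a set set"

definition coll :: "'a point_line \<Rightarrow> 'a \<Rightarrow> 'a \<Rightarrow> bool" where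
  "coll \<P> p q \<longleftrightarrow> p \<in> points \<P> \<and> q \<in> points \<P> \<and>
     (p = q \<or> (\<exists>l\<in>lines \<P>. p \<in> l \<and> q \<in> l))"

definition partial_linear_space :: "'a point_line \<Rightarrow> bool" where
  "partial_linear_space \<P> \<longleftrightarrow>
     (\<forall>l\<in>lines \<P>. l \<subseteq> points \<P>) \<and>
     (\<forall>p q. p \<noteq> q \<and> coll \<P> p q \<longrightarrow> (\<exists>!l. l \<in> lines \<P> \<and> p \<in> l \<and> q \<in> l))"

definition pl_subspace :: "'a point_line \<Rightarrow> 'a set \<Rightarrow> bool" where
  "pl_subspace \<P> X \<longleftrightarrow> X \<subseteq> points \<P> \<and>
     (\<forall>l\<in>lines \<P>. \<forall>p\<in>l \<inter> X. \<forall>q\<in>l \<inter> X. p \<noteq> q \<longrightarrow> l \<subseteq> X)"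

definition singular_subspace :: "'a point_line \<Rightarrow> 'a set \<Rightarrow> bool" where
  "singular_subspace \<P> X \<longleftrightarrow> pl_subspace \<P> X \<and> (\<forall>p\<in>X. \<forall>q\<in>X. coll \<P> p q)"

definition maximal_singular :: "'a point_line \<Rightarrow> 'a set \<Rightarrow> bool" where
  "maximal_singular \<P> X \<longleftrightarrow> singular_subspace \<P> X \<and>
     (\<forall>Y. singular_subspace \<P> Y \<and> X \<subseteq> Y \<longrightarrow> Y = X)"

definition at_least_three :: "'a set \<Rightarrow> bool" where
  "at_least_three l \<longleftrightarrow> (\<exists>a\<in>l. \<exists>b\<in>l. \<exists>c\<in>l. a \<noteq> b \<and> a \<noteq> c \<and> b \<noteq> c)"

definition polar_space :: "'a point_line \<Rightarrow> bool" where
  "polar_space \<P> \<longleftrightarrow> partial_linear_space \<P> \<and>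
     (\<forall>l\<in>lines \<P>. at_least_three l) \<and>
     (\<forall>p\<in>points \<P>. \<exists>q\<in>points \<P>. \<not> coll \<P> p q) \<and>
     (\<forall>p\<in>points \<P>. \<forall>l\<in>lines \<P>.
        (\<exists>!q. q \<in> l \<and> coll \<P> p q) \<or> (\<forall>q\<in>l. coll \<P> p q)) \<and>
     (\<forall>F. (\<forall>X\<in>F. singular_subspace \<P> X) \<and> chain_subset F \<longrightarrow> finite F)"

definition pl_span :: "'a point_line \<Rightarrow> 'a set \<Rightarrow> 'a set" where
  "pl_span \<P> X = \<Inter> {Y. pl_subspace \<P> Y \<and> X \<subseteq> Y}"

definition pl_independent :: "'a point_line \<Rightarrow> 'a set \<Rightarrow> bool" where
  "pl_independent \<P> B \<longleftrightarrow> (\<forall>b\<in>B. b \<notin> pl_span \<P> (B - {b}))"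

text \<open>The set of singular subspaces of projective dimension \<open>k\<close>: those with a base of
  \<open>k + 1\<close> points. Dimensions are integers, the empty subspace having dimension \<open>-1\<close>.\<close>

definition grassmannian :: "'a point_line \<Rightarrow> int \<Rightarrow> 'a set set" where
  "grassmannian \<P> k = {X. singular_subspace \<P> X \<and>
     (\<exists>B\<subseteq>X. finite B \<and> pl_independent \<P> B \<and> pl_span \<P> B = X \<and> int (card B) = k + 1)}"

text \<open>The third conjunct is the Veblen--Young axiom.\<close>

definition projective_space :: "'a point_line \<Rightarrow> bool" where
  "projective_space \<P> \<longleftrightarrow>
     (\<forall>l\<in>lines \<P>. l \<subseteq> points \<P> \<and> at_least_three l) \<and>
     (\<forall>p\<in>points \<P>. \<forall>q\<in>points \<P>. p \<noteq> q \<longrightarrow> (\<exists>!l. l \<in> lines \<P> \<and> p \<in> l \<and> q \<in> l)) \<and>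
     (\<forall>l\<in>lines \<P>. \<forall>l'\<in>lines \<P>. \<forall>m\<in>lines \<P>. \<forall>m'\<in>lines \<P>. \<forall>p\<in>l \<inter> l'.
        l \<noteq> l' \<and> p \<notin> m \<and> p \<notin> m' \<and>
        m \<inter> l \<noteq> {} \<and> m \<inter> l' \<noteq> {} \<and> m' \<inter> l \<noteq> {} \<and> m' \<inter> l' \<noteq> {} \<longrightarrow> m \<inter> m' \<noteq> {})"

definition polar_space_of_rank :: "'a point_line \<Rightarrow> nat \<Rightarrow> bool" where
  "polar_space_of_rank \<P> n \<longleftrightarrow> polar_space \<P> \<and> n \<ge> 3 \<and>
     (\<forall>X. maximal_singular \<P> X \<longrightarrow>
        projective_space \<lparr>points = X, lines = {l \<in> lines \<P>. l \<subseteq> X}\<rparr> \<and>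
        X \<in> grassmannian \<P> (int n - 1))"

definition dual_polar_edges :: "'a point_line \<Rightarrow> nat \<Rightarrow> 'a set rel" where
  "dual_polar_edges \<P> n = {(S, T). S \<in> grassmannian \<P> (int n - 1) \<and>
     T \<in> grassmannian \<P> (int n - 1) \<and> S \<inter> T \<in> grassmannian \<P> (int n - 2)}"

text \<open>The least length of a walk; \<open>\<infinity>\<close> if there is none.\<close>

definition graph_dist :: "'v rel \<Rightarrow> 'v \<Rightarrow> 'v \<Rightarrow> enat" where
  "graph_dist E x y = (INF k\<in>{k. (x, y) \<in> E ^^ k}. enat k)"

definition isometric_embedding ::
  "'v set \<Rightarrow> 'v rel \<Rightarrow> 'w set \<Rightarrow> 'w rel \<Rightarrow> ('v \<Rightarrow> 'w) \<Rightarrow> bool" where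
  "isometric_embedding V E V' E' f \<longleftrightarrow> f \<in> V \<rightarrow> V' \<and> inj_on f V \<and>
     (\<forall>x\<in>V. \<forall>y\<in>V. graph_dist E' (f x) (f y) = graph_dist E x y)"

definition star_over :: "'a point_line \<Rightarrow> 'a set \<Rightarrow> int \<Rightarrow> 'a set set" where
  "star_over \<P> M k = {X \<in> grassmannian \<P> k. M \<subseteq> X}"

text \<open>To be used with \<open>k = dim M + 1\<close>. For \<open>M = {}\<close> and \<open>k = 0\<close> the points are the singletons
  of points of \<open>\<P>\<close>, which gives a copy of \<open>\<P>\<close>.\<close>

definition star_polar_space :: "'a point_line \<Rightarrow> 'a set \<Rightarrow> int \<Rightarrow> 'a set point_line" where
  "star_polar_space \<P> M k = \<lparr>points = star_over \<P> M k,
     lines = {{X \<in> star_over \<P> M k. X \<subseteq> U} | U. U \<in> star_over \<P> M (k + 1)}\<rparr>"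

definition polar_frame :: "'a point_line \<Rightarrow> nat \<Rightarrow> 'a set \<Rightarrow> bool" where
  "polar_frame \<P> n F \<longleftrightarrow> F \<subseteq> points \<P> \<and> finite F \<and> card F = 2 * n \<and>
     (\<forall>p\<in>F. \<exists>!q. q \<in> F \<and> \<not> coll \<P> p q)"

definition frames_preserving ::
  "nat \<Rightarrow> 'a point_line \<Rightarrow> 'b point_line \<Rightarrow> ('a \<Rightarrow> 'b) \<Rightarrow> bool" where
  "frames_preserving n \<P> \<P>' g \<longleftrightarrow> g \<in> points \<P> \<rightarrow> points \<P>' \<and>
     (\<forall>F. polar_frame \<P> n F \<longrightarrow> polar_frame \<P>' n (g ` F))"

end

theory Submission
  imports Defs
begin

text \<open>
  Write \<open>rk\<close> for projective dimension plus one. The distance of two maximal singular subspaces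
  \<open>S\<close>, \<open>T\<close> of a rank \<open>n\<close> polar space is \<open>n - rk (S \<inter> T)\<close>, so an isometric embedding \<open>f\<close> shifts the
  ranks of intersections by \<open>n' - n\<close>. The crucial point is that \<open>f S \<inter> f T\<close> depends only on \<open>S \<inter> T\<close>:
  the set of all \<open>U\<close> with \<open>f S \<inter> f T \<subseteq> f U\<close> is closed under geodesics and contains every maximal
  clique of which it contains two elements; if it contains \<open>S\<close> and \<open>T\<close>, this forces it to contain all
  maximal \<open>U \<supseteq> S \<inter> T\<close>. As every singular \<open>K\<close> has the form \<open>S \<inter> T\<close>, the intersection \<open>core K\<close> of all
  \<open>f U\<close> with \<open>K \<subseteq> U\<close> has rank \<open>n' - n + rk K\<close>. Take \<open>M = core {}\<close> and \<open>g p = core {p}\<close>; this map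
  preserves collinearity and non-collinearity, hence frames.
\<close>

section \<open>Singular subspaces of a polar space\<close>

lemma pl_span_superset: "A \<subseteq> pl_span \<P> A"
  unfolding pl_span_def by blast

lemma pl_span_least: "pl_subspace \<P> Y \<Longrightarrow> A \<subseteq> Y \<Longrightarrow> pl_span \<P> A \<subseteq> Y"
  unfolding pl_span_def by blast

lemma pl_span_mono: "A \<subseteq> B \<Longrightarrow> pl_span \<P> A \<subseteq> pl_span \<P> B"
  unfolding pl_span_def by blast

lemma pl_span_idem: "pl_span \<P> (pl_span \<P> A) = pl_span \<P> A"
proof
  show "pl_span \<P> (pl_span \<P> A) \<subseteq> pl_span \<P> A"
  proof
    fix x assume x: "x \<in> pl_span \<P> (pl_span \<P> A)"
    have "x \<in> Y" if "pl_subspace \<P> Y" "A \<subseteq> Y" for Y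
      using pl_span_least[OF that(1) pl_span_least[OF that]] x by blast
    then show "x \<in> pl_span \<P> A" by (simp add: pl_span_def)
  qed
qed (rule pl_span_superset)

lemma pl_span_of_subspace: "pl_subspace \<P> X \<Longrightarrow> pl_span \<P> X = X"
  by (simp add: pl_span_least pl_span_superset subset_antisym)

lemma pl_span_insert_span: "pl_span \<P> (insert x (pl_span \<P> A)) = pl_span \<P> (insert x A)"
proof
  have "insert x (pl_span \<P> A) \<subseteq> pl_span \<P> (insert x A)"
    using pl_span_mono[of A "insert x A" \<P>] pl_span_superset[of "insert x A" \<P>] by blast
  then show "pl_span \<P> (insert x (pl_span \<P> A)) \<subseteq> pl_span \<P> (insert x A)"
    using pl_span_mono[of _ "pl_span \<P> (insert x A)" \<P>] by (simp add: pl_span_idem)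
  show "pl_span \<P> (insert x A) \<subseteq> pl_span \<P> (insert x (pl_span \<P> A))"
    by (intro pl_span_mono insert_mono pl_span_superset)
qed

locale ranked_polar_space =
  fixes \<P> :: "'a point_line" and n :: nat
  assumes rank: "polar_space_of_rank \<P> n"
begin

abbreviation collinear (infix "\<sim>" 50) where "p \<sim> q \<equiv> coll \<P> p q"
abbreviation "sing \<equiv> singular_subspace \<P>"
abbreviation "maxsing \<equiv> maximal_singular \<P>"
abbreviation "cl \<equiv> pl_span \<P>"

definition perp :: "'a set \<Rightarrow> 'a set" where
  "perp A = {q \<in> points \<P>. \<forall>a\<in>A. q \<sim> a}"

lemma polar: "polar_space \<P>"
  using rank by (simp add: polar_space_of_rank_def)

lemma partial_linear: "partial_linear_space \<P>"
  using polar by (simp add: polar_space_def)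

lemma coll_sym: "p \<sim> q \<Longrightarrow> q \<sim> p"
  by (auto simp: coll_def)

lemma coll_commute: "p \<sim> q \<longleftrightarrow> q \<sim> p"
  by (auto simp: coll_def)

lemma coll_refl: "p \<in> points \<P> \<Longrightarrow> p \<sim> p"
  by (auto simp: coll_def)

lemma coll_points: "p \<sim> q \<Longrightarrow> p \<in> points \<P>" "p \<sim> q \<Longrightarrow> q \<in> points \<P>"
  by (auto simp: coll_def)

lemma line_points: "l \<in> lines \<P> \<Longrightarrow> p \<in> l \<Longrightarrow> p \<in> points \<P>"
  using partial_linear unfolding partial_linear_space_def by blast

lemma line_coll: "l \<in> lines \<P> \<Longrightarrow> p \<in> l \<Longrightarrow> q \<in> l \<Longrightarrow> p \<sim> q"
  using line_points by (auto simp: coll_def)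

lemma coll_lineE:
  assumes "p \<sim> q" "p \<noteq> q" obtains l where "l \<in> lines \<P>" "p \<in> l" "q \<in> l"
  using assms by (auto simp: coll_def)

lemma line_unique:
  assumes "l \<in> lines \<P>" "m \<in> lines \<P>" "p \<in> l" "q \<in> l" "p \<in> m" "q \<in> m" "p \<noteq> q"
  shows "l = m"
proof -
  have "\<exists>!l. l \<in> lines \<P> \<and> p \<in> l \<and> q \<in> l"
    using partial_linear line_coll[OF assms(1,3,4)] assms(7)
    unfolding partial_linear_space_def by blast
  then show ?thesis using assms by blast
qed

lemma one_or_all:
  assumes "x \<in> points \<P>" "l \<in> lines \<P>"
  shows "(\<exists>!q. q \<in> l \<and> x \<sim> q) \<or> (\<forall>q\<in>l. x \<sim> q)"
  using polar assms by (simp add: polar_space_def)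

lemma line_all:
  assumes "l \<in> lines \<P>" "x \<sim> a" "x \<sim> b" "a \<in> l" "b \<in> l" "a \<noteq> b" "c \<in> l"
  shows "x \<sim> c"
  using one_or_all[OF coll_points(1)[OF assms(2)] assms(1)] assms by blast

lemma line_one:
  assumes "l \<in> lines \<P>" "x \<in> points \<P>"
  obtains q where "q \<in> l" "x \<sim> q"
proof -
  have "at_least_three l" using polar assms by (simp add: polar_space_def)
  then have "l \<noteq> {}" by (auto simp: at_least_three_def)
  then show ?thesis using one_or_all[OF assms(2,1)] that by blast
qed

lemma nondegenerate:
  assumes "p \<in> points \<P>" obtains q where "q \<in> points \<P>" "\<not> p \<sim> q"
proof -
  have "\<forall>p\<in>points \<P>. \<exists>q\<in>points \<P>. \<not> p \<sim> q"
    using polar by (simp add: polar_space_def)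
  then show ?thesis using assms that by blast
qed

lemma subspace_line:
  assumes "pl_subspace \<P> X" "l \<in> lines \<P>" "a \<in> l" "b \<in> l" "a \<in> X" "b \<in> X" "a \<noteq> b" "c \<in> l"
  shows "c \<in> X"
  using assms unfolding pl_subspace_def by blast

lemma subspaceI:
  assumes "X \<subseteq> points \<P>"
    and "\<And>l a b c. l \<in> lines \<P> \<Longrightarrow> a \<in> l \<Longrightarrow> b \<in> l \<Longrightarrow> a \<in> X \<Longrightarrow> b \<in> X \<Longrightarrow> a \<noteq> b \<Longrightarrow> c \<in> l \<Longrightarrow> c \<in> X"
  shows "pl_subspace \<P> X"
  unfolding pl_subspace_def
proof (intro conjI ballI impI subsetI)
  fix x assume "x \<in> X" then show "x \<in> points \<P>" using assms(1) by blast
next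
  fix l p q c assume *: "l \<in> lines \<P>" "p \<in> l \<inter> X" "q \<in> l \<inter> X" "p \<noteq> q" "c \<in> l"
  then show "c \<in> X" using assms(2)[of l p q c] by simp
qed

lemma subspace_Int:
  assumes X: "pl_subspace \<P> X" and Y: "pl_subspace \<P> Y" shows "pl_subspace \<P> (X \<inter> Y)"
proof (rule subspaceI)
  show "X \<inter> Y \<subseteq> points \<P>" using X by (auto simp: pl_subspace_def)
  fix l a b c assume "l \<in> lines \<P>" "a \<in> l" "b \<in> l" "a \<in> X \<inter> Y" "b \<in> X \<inter> Y" "a \<noteq> b" "c \<in> l"
  then show "c \<in> X \<inter> Y" using subspace_line[OF X, of l a b c] subspace_line[OF Y, of l a b c] by simp
qed

lemma subspace_span:
  assumes A: "A \<subseteq> points \<P>" shows "pl_subspace \<P> (cl A)"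
proof (rule subspaceI)
  have "pl_subspace \<P> (points \<P>)"
    by (rule subspaceI) (auto intro: line_points)
  then show "cl A \<subseteq> points \<P>" using A by (rule pl_span_least)
  fix l a b c assume *: "l \<in> lines \<P>" "a \<in> l" "b \<in> l" "a \<in> cl A" "b \<in> cl A" "a \<noteq> b" "c \<in> l"
  have "c \<in> Y" if Y: "pl_subspace \<P> Y" "A \<subseteq> Y" for Y
    using subspace_line[OF Y(1) *(1,2,3) _ _ *(6,7)] pl_span_least[OF Y] *(4,5) by blast
  then show "c \<in> cl A" by (simp add: pl_span_def)
qed

text \<open>This is the one-or-all axiom: a point collinear with two points of a line is collinear
  with all of it.\<close>

lemma subspace_perp: "pl_subspace \<P> (perp A)"
proof (rule subspaceI)
  show "perp A \<subseteq> points \<P>" by (auto simp: perp_def)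
  fix l p q c assume *: "l \<in> lines \<P>" "p \<in> l" "q \<in> l" "p \<in> perp A" "q \<in> perp A" "p \<noteq> q" "c \<in> l"
  have "c \<sim> a" if "a \<in> A" for a
    using * that line_all[OF *(1), of a p q c] by (auto simp: perp_def coll_commute)
  then show "c \<in> perp A" using line_points[OF *(1,7)] by (simp add: perp_def)
qed

lemma sing_subspace: "sing X \<Longrightarrow> pl_subspace \<P> X"
  by (simp add: singular_subspace_def)

lemma sing_points: "sing X \<Longrightarrow> X \<subseteq> points \<P>"
  by (simp add: singular_subspace_def pl_subspace_def)

lemma sing_coll: "sing X \<Longrightarrow> p \<in> X \<Longrightarrow> q \<in> X \<Longrightarrow> p \<sim> q"
  by (simp add: singular_subspace_def)

lemma sing_perp: "sing X \<Longrightarrow> A \<subseteq> X \<Longrightarrow> X \<subseteq> perp A"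
  using sing_points sing_coll by (auto simp: perp_def)

lemma sing_Int: "sing X \<Longrightarrow> pl_subspace \<P> Y \<Longrightarrow> sing (X \<inter> Y)"
  by (simp add: singular_subspace_def subspace_Int)

lemma sing_Int': "sing X \<Longrightarrow> sing Y \<Longrightarrow> sing (X \<inter> Y)"
  by (simp add: singular_subspace_def subspace_Int)

lemma sing_subset: "sing X \<Longrightarrow> pl_subspace \<P> Y \<Longrightarrow> Y \<subseteq> X \<Longrightarrow> sing Y"
  by (auto simp: singular_subspace_def)

lemma sing_empty: "sing {}"
  by (simp add: singular_subspace_def pl_subspace_def)

lemma sing_singleton: "p \<in> points \<P> \<Longrightarrow> sing {p}"
  by (auto simp: singular_subspace_def pl_subspace_def coll_refl)

lemma perp_swap:
  assumes "A \<subseteq> points \<P>" "B \<subseteq> perp A" shows "A \<subseteq> perp B"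
proof
  fix a assume a: "a \<in> A"
  have "a \<sim> b" if "b \<in> B" for b
    using subsetD[OF assms(2) that] a coll_sym[of b a] by (simp add: perp_def)
  then show "a \<in> perp B" using a assms(1) by (auto simp: perp_def)
qed

text \<open>The subspace \<open>perp A\<close> contains \<open>A\<close>, hence \<open>cl A\<close>;
  swapping sides puts \<open>A\<close>, and then \<open>cl A\<close>, into the subspace
  \<open>perp (cl A)\<close>.\<close>

lemma sing_span:
  assumes A: "A \<subseteq> points \<P>" and c: "\<And>p q. p \<in> A \<Longrightarrow> q \<in> A \<Longrightarrow> p \<sim> q"
  shows "sing (cl A)"
proof -
  have "cl A \<subseteq> perp A"
    by (rule pl_span_least[OF subspace_perp]) (use A c in \<open>auto simp: perp_def\<close>)
  then have "A \<subseteq> perp (cl A)" by (rule perp_swap[OF A])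
  then have "cl A \<subseteq> perp (cl A)"
    by (rule pl_span_least[OF subspace_perp])
  then show ?thesis
    using subspace_span[OF A] by (auto simp: singular_subspace_def perp_def)
qed

lemma sing_span_insert:
  assumes "sing X" "x \<in> perp X" shows "sing (cl (insert x X))"
  by (rule sing_span)
    (use assms sing_points[OF assms(1)] in \<open>auto simp: perp_def coll_commute coll_refl sing_coll[OF assms(1)]\<close>)

lemma maxsing_sing: "maxsing X \<Longrightarrow> sing X"
  by (simp add: maximal_singular_def)

text \<open>Zorn's lemma applies because chains of singular subspaces are finite, so the union of a
  nonempty chain is its largest member.\<close>

lemma sing_in_maxsing:
  assumes "sing X" obtains V where "maxsing V" "X \<subseteq> V"
proof -
  let ?A = "{Y. sing Y \<and> X \<subseteq> Y}"
  have "\<exists>M\<in>?A. \<forall>Y\<in>?A. M \<subseteq> Y \<longrightarrow> Y = M"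
  proof (rule subset_Zorn_nonempty)
    show "?A \<noteq> {}" using assms by blast
    fix C assume C: "C \<noteq> {}" "subset.chain ?A C"
    then have "(\<forall>Y\<in>C. sing Y) \<and> chain_subset C"
      by (auto simp: chain_subset_def subset_chain_def)
    moreover have "\<forall>F. (\<forall>X\<in>F. sing X) \<and> chain_subset F \<longrightarrow> finite F"
      using polar by (simp add: polar_space_def)
    ultimately have "finite C" by blast
    then have "\<Union>C \<in> C"
      using C by (intro Union_in_chain) (auto simp: subset_chain_def)
    then show "\<Union>C \<in> ?A" using C by (auto simp: subset_chain_def)
  qed
  then obtain M where M: "M \<in> ?A" "\<forall>Y\<in>?A. M \<subseteq> Y \<longrightarrow> Y = M" by (rule bexE)
  have "Y = M" if "sing Y" "M \<subseteq> Y" for Y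
    using M that by (simp add: subset_trans[of X M Y])
  then have "maxsing M" using M(1) by (simp add: maximal_singular_def)
  then show ?thesis using that M(1) by simp
qed

lemma maxsing_perp:
  assumes V: "maxsing V" and x: "x \<in> perp V" shows "x \<in> V"
proof -
  have "sing (cl (insert x V))"
    using sing_span_insert[OF maxsing_sing[OF V] x] .
  then have "cl (insert x V) = V"
    using V pl_span_superset[of "insert x V" \<P>] by (auto simp: maximal_singular_def)
  then show ?thesis using pl_span_superset[of "insert x V" \<P>] by blast
qed

text \<open>The Veblen--Young axiom of the projective space \<open>V\<close>, with the points where
  \<open>m\<close> and \<open>m'\<close> meet \<open>l\<close> and \<open>l'\<close> named
  explicitly.\<close>

lemma veblen:
  assumes V: "maxsing V"
    and l: "l \<in> lines \<P>" "l \<subseteq> V" "l' \<in> lines \<P>" "l' \<subseteq> V"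
    and m: "m \<in> lines \<P>" "m \<subseteq> V" "m' \<in> lines \<P>" "m' \<subseteq> V"
    and p: "p \<in> l" "p \<in> l'" "l \<noteq> l'" "p \<notin> m" "p \<notin> m'"
    and i: "a \<in> m" "a \<in> l" "b \<in> m" "b \<in> l'" "c \<in> m'" "c \<in> l" "d \<in> m'" "d \<in> l'"
  obtains q where "q \<in> m" "q \<in> m'"
proof -
  have "projective_space \<lparr>points = V, lines = {l \<in> lines \<P>. l \<subseteq> V}\<rparr>"
    using rank V by (simp add: polar_space_of_rank_def)
  then have vy: "\<forall>l\<in>{l \<in> lines \<P>. l \<subseteq> V}. \<forall>l'\<in>{l \<in> lines \<P>. l \<subseteq> V}. \<forall>m\<in>{l \<in> lines \<P>. l \<subseteq> V}.
      \<forall>m'\<in>{l \<in> lines \<P>. l \<subseteq> V}. \<forall>p\<in>l \<inter> l'.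
        l \<noteq> l' \<and> p \<notin> m \<and> p \<notin> m' \<and>
        m \<inter> l \<noteq> {} \<and> m \<inter> l' \<noteq> {} \<and> m' \<inter> l \<noteq> {} \<and> m' \<inter> l' \<noteq> {} \<longrightarrow> m \<inter> m' \<noteq> {}"
    unfolding projective_space_def point_line.simps by (elim conjE)
  have mem: "l \<in> {l \<in> lines \<P>. l \<subseteq> V}" "l' \<in> {l \<in> lines \<P>. l \<subseteq> V}"
    "m \<in> {l \<in> lines \<P>. l \<subseteq> V}" "m' \<in> {l \<in> lines \<P>. l \<subseteq> V}" "p \<in> l \<inter> l'"
    using l m p by simp_all
  have "m \<inter> l \<noteq> {}" "m \<inter> l' \<noteq> {}" "m' \<inter> l \<noteq> {}" "m' \<inter> l' \<noteq> {}"
    using i by blast+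
  then have "m \<inter> m' \<noteq> {}"
    using vy[THEN bspec, OF mem(1), THEN bspec, OF mem(2), THEN bspec, OF mem(3),
        THEN bspec, OF mem(4), THEN bspec, OF mem(5)] p(3-5) by simp
  then show ?thesis using that by blast
qed

section \<open>Cones: the join of a point and a subspace\<close>

definition cone :: "'a \<Rightarrow> 'a set \<Rightarrow> 'a set" where
  "cone x H = insert x {y. \<exists>l\<in>lines \<P>. x \<in> l \<and> y \<in> l \<and> (\<exists>h\<in>l \<inter> H. h \<noteq> x)}"

lemma coneI:
  assumes "l \<in> lines \<P>" "x \<in> l" "y \<in> l" "h \<in> l" "h \<in> H" "h \<noteq> x"
  shows "y \<in> cone x H"
  using assms unfolding cone_def by blast

lemma coneE:
  assumes "y \<in> cone x H" "y \<noteq> x"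
  obtains l h where "l \<in> lines \<P>" "x \<in> l" "y \<in> l" "h \<in> l" "h \<in> H" "h \<noteq> x"
  using assms unfolding cone_def by blast

lemma cone_apex: "x \<in> cone x H"
  by (simp add: cone_def)

lemma cone_base:
  assumes "sing V" "H \<subseteq> V" "x \<in> V" shows "H \<subseteq> cone x H"
proof
  fix h assume h: "h \<in> H"
  show "h \<in> cone x H"
  proof (cases "h = x")
    case False
    have "x \<sim> h" using sing_coll[OF assms(1,3)] h assms(2) by blast
    then obtain l where "l \<in> lines \<P>" "x \<in> l" "h \<in> l"
      using coll_lineE False by metis
    then show ?thesis using coneI False h by metis
  qed (simp add: cone_apex)
qed

text \<open>In a projective space the lines from a point to a subspace already fill their join.
  Lines through the apex are generators; any other line needs two applications of the Veblen--Young
  axiom.\<close>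

lemma subspace_cone:
  assumes V: "maxsing V" and H: "pl_subspace \<P> H" "H \<subseteq> V" and x: "x \<in> V"
  shows "pl_subspace \<P> (cone x H)"
proof -
  note sV = maxsing_sing[OF V]
  note subV = sing_subspace[OF sV]
  note HJ = cone_base[OF sV H(2) x]
  have JV: "cone x H \<subseteq> V"
  proof
    fix y assume y: "y \<in> cone x H"
    show "y \<in> V"
    proof (cases "y = x")
      case False
      then obtain l h where l: "l \<in> lines \<P>" "x \<in> l" "y \<in> l" "h \<in> l" "h \<in> H" "h \<noteq> x"
        using coneE[OF y] by blast
      then show ?thesis using subspace_line[OF subV l(1,2,4) x _ _ l(3)] H(2) by blast
    qed (use x in simp)
  qed
  have closed: "c \<in> cone x H" if m: "m \<in> lines \<P>" "y \<in> m" "y \<in> cone x H" "z \<in> m" "z \<in> cone x H"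
    "y \<noteq> z" "c \<in> m" for m y z c
  proof (cases "x \<in> m")
    case True
    have "\<exists>w\<in>m. w \<in> cone x H \<and> w \<noteq> x" using m by metis
    then obtain w where w: "w \<in> m" "w \<in> cone x H" "w \<noteq> x" by blast
    obtain l h where l: "l \<in> lines \<P>" "x \<in> l" "w \<in> l" "h \<in> l" "h \<in> H" "h \<noteq> x"
      using coneE[OF w(2,3)] .
    have "l = m" using line_unique[OF l(1) m(1) l(2,3) True w(1)] w(3) by simp
    then show ?thesis using coneI[OF m(1) True m(7) _ l(5,6)] l by simp
  next
    case False
    have yV: "y \<in> V" and zV: "z \<in> V" using JV m by auto
    have mV: "m \<subseteq> V" using subspace_line[OF subV m(1,2,4) yV zV m(6)] by blast
    have "y \<noteq> x" "z \<noteq> x" using m False by auto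
    obtain l h where l: "l \<in> lines \<P>" "x \<in> l" "y \<in> l" "h \<in> l" "h \<in> H" "h \<noteq> x"
      using coneE[OF m(3) \<open>y \<noteq> x\<close>] .
    obtain l' h' where l': "l' \<in> lines \<P>" "x \<in> l'" "z \<in> l'" "h' \<in> l'" "h' \<in> H" "h' \<noteq> x"
      using coneE[OF m(5) \<open>z \<noteq> x\<close>] .
    have hV: "h \<in> V" "h' \<in> V" using l l' H by auto
    have ll': "l \<noteq> l'" using line_unique[OF l(1) m(1) l(3) _ m(2,4,6)] l(2) l'(3) False by metis
    have hh': "h \<noteq> h'" using line_unique[OF l(1) l'(1) l(2,4) l'(2)] l(6) l'(4) ll' by metis
    obtain m' where m': "m' \<in> lines \<P>" "h \<in> m'" "h' \<in> m'"
      using coll_lineE[OF sing_coll[OF sV hV] hh'] .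
    have m'H: "m' \<subseteq> H" using subspace_line[OF H(1) m' l(5) l'(5) hh'] by blast
    have lV: "l \<subseteq> V" using subspace_line[OF subV l(1,2,4) x hV(1)] l(6) by blast
    have l'V: "l' \<subseteq> V" using subspace_line[OF subV l'(1,2,4) x hV(2)] l'(6) by blast
    have m'V: "m' \<subseteq> V" using m'H H by blast
    show ?thesis
    proof (cases "c \<in> H")
      case True then show ?thesis using HJ by blast
    next
      case cH: False
      have cx: "x \<noteq> c" using m False by metis
      have xm': "x \<notin> m'"
      proof
        assume "x \<in> m'"
        then have "l = m'" "l' = m'"
          using line_unique[OF l(1) m'(1) l(2,4) _ m'(2)] line_unique[OF l'(1) m'(1) l'(2,4) _ m'(3)]
            l(6) l'(6) by metis+
        then show False using ll' by simp
      qed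
      \<comment> \<open>First application, with apex \<open>x\<close>: the line \<open>m\<close>
        through \<open>y\<close> and \<open>z\<close> meets the line \<open>m'\<close> through their
        feet \<open>h\<close> and \<open>h'\<close> in \<open>H\<close>.\<close>
      obtain o' where o': "o' \<in> m" "o' \<in> m'"
        using veblen[OF V l(1) lV l'(1) l'V m(1) mV m'(1) m'V l(2) l'(2) ll' False xm' m(2) l(3) m(4) l'(3) m'(2) l(4) m'(3) l'(4)] .
      have cV: "c \<in> V" using m mV by auto
      obtain k where k: "k \<in> lines \<P>" "x \<in> k" "c \<in> k"
        using coll_lineE[OF sing_coll[OF sV x cV] cx] .
      have kV: "k \<subseteq> V" using subspace_line[OF subV k x cV cx] by blast
      \<comment> \<open>Second application, with apex \<open>y\<close>: the lines \<open>l\<close>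
        and \<open>m\<close> are both met by \<open>k\<close> (in \<open>x\<close> and
        \<open>c\<close>) and by \<open>m'\<close> (in \<open>h\<close> and \<open>o'\<close>), so
        \<open>k\<close> meets \<open>m'\<close>, which lies in \<open>H\<close>. It is stated for a
        variable \<open>y\<close> because the apex has to avoid \<open>H\<close> and
        \<open>c\<close>, and either of the two original points may fail to.\<close>
      have meet: "c \<in> cone x H" if y: "y \<in> m" "y \<in> l" "y \<notin> H" "y \<noteq> c" "l \<in> lines \<P>" "l \<subseteq> V" "x \<in> l"
          "h \<in> l" "h \<in> m'" for y l h
      proof -
        have yk: "y \<notin> k" using line_unique[OF k(1) m(1) _ k(3) y(1) m(7) y(4)] k(2) False by metis
        have ym': "y \<notin> m'" using m'H y by blast
        have lm: "l \<noteq> m" using y False by metis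
        obtain q where q: "q \<in> k" "q \<in> m'"
          using veblen[OF V y(5,6) m(1) mV k(1) kV m'(1) m'V y(2,1) lm yk ym' k(2) y(7) k(3) m(7) y(9,8) o'(2,1)] .
        show ?thesis using coneI[OF k q(1)] q(2) m'H xm' by blast
      qed
      consider "y = c" | "z = c" | "y \<noteq> c" "y \<notin> H" | "z \<noteq> c" "z \<notin> H" | "y \<in> H" "z \<in> H" by blast
      then show ?thesis
      proof cases
        case 1 then show ?thesis using m by simp
      next
        case 2 then show ?thesis using m by simp
      next
        case 3
        then show ?thesis using meet[OF m(2) l(3) _ _ l(1) lV l(2,4) m'(2)] by blast
      next
        case 4
        then show ?thesis using meet[OF m(4) l'(3) _ _ l'(1) l'V l'(2,4) m'(3)] by blast
      next
        case 5
        then show ?thesis using subspace_line[OF H(1) m(1,2,4) 5 m(6,7)] HJ by blast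
      qed
    qed
  qed
  show ?thesis
  proof (rule subspaceI)
    show "cone x H \<subseteq> points \<P>" using JV sing_points[OF sV] by blast
  qed (use closed in metis)
qed

text \<open>Inside a maximal singular subspace containing the span, the cone over \<open>H\<close>
  with apex \<open>x\<close> is a subspace containing \<open>x\<close> and \<open>H\<close>, so it
  contains the span.\<close>

lemma span_insertE:
  assumes "sing H" "x \<in> perp H" "y \<in> cl (insert x H)" "y \<noteq> x"
  obtains l h where "l \<in> lines \<P>" "x \<in> l" "y \<in> l" "h \<in> l" "h \<in> H" "h \<noteq> x"
proof -
  obtain V where V: "maxsing V" "cl (insert x H) \<subseteq> V"
    using sing_in_maxsing[OF sing_span_insert[OF assms(1,2)]] .
  have sV: "sing V" using maxsing_sing[OF V(1)] .
  have iV: "insert x H \<subseteq> V" using V pl_span_superset[of "insert x H" \<P>] by blast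
  have "cl (insert x H) \<subseteq> cone x H"
    using subspace_cone[OF V(1) sing_subspace[OF assms(1)]] cone_base[OF sV, of H x] iV
    by (intro pl_span_least) (auto simp: cone_apex)
  then have "y \<in> cone x H" using assms(3) by blast
  then show ?thesis using coneE assms(4) that by metis
qed

section \<open>Rank\<close>

text \<open>By \<open>span_insertE\<close>, \<open>y\<close> lies on a line joining \<open>x\<close>
  to some \<open>h\<close> in \<open>cl A\<close>. As \<open>h\<close> differs from
  \<open>y\<close>, that line is also spanned by \<open>y\<close> and \<open>h\<close>, which
  recovers \<open>x\<close>.\<close>

lemma span_exchange:
  assumes V: "sing V" and A: "A \<subseteq> V" and x: "x \<in> V" and y: "y \<in> cl (insert x A)" "y \<notin> cl A"
  shows "x \<in> cl (insert y A)"
proof (cases "y = x")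
  case True then show ?thesis using pl_span_superset[of "insert y A" \<P>] by blast
next
  case False
  have clV: "cl A \<subseteq> V" "cl (insert x A) \<subseteq> V"
    using pl_span_least[OF sing_subspace[OF V]] A x by simp_all
  have Ap: "A \<subseteq> points \<P>" using A sing_points[OF V] by blast
  have s: "sing (cl A)" using sing_subset[OF V subspace_span[OF Ap] clV(1)] .
  have xp: "x \<in> perp (cl A)" using sing_perp[OF V clV(1)] x by blast
  have "y \<in> cl (insert x (cl A))" using y by (simp add: pl_span_insert_span)
  from span_insertE[OF s xp this False] obtain l h
    where l: "l \<in> lines \<P>" "x \<in> l" "y \<in> l" "h \<in> l" "h \<in> cl A" "h \<noteq> x" .
  have "y \<in> points \<P>" using line_points l by blast
  then have sub: "pl_subspace \<P> (cl (insert y A))" using Ap by (intro subspace_span) simp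
  have "h \<in> cl (insert y A)" using l pl_span_mono[of A "insert y A" \<P>] by blast
  moreover have "y \<in> cl (insert y A)" using pl_span_superset[of "insert y A" \<P>] by blast
  moreover have "h \<noteq> y" using l y by blast
  ultimately show ?thesis using subspace_line[OF sub l(1,4,3)] l(2) by blast
qed

text \<open>If some \<open>c\<close> in \<open>J\<close> fell into the span of the other points,
  exchanging it with \<open>b\<close> would place \<open>b\<close> in \<open>cl J\<close>.\<close>

lemma independent_insert:
  assumes V: "sing V" and J: "J \<subseteq> V" "b \<in> V" and ind: "pl_independent \<P> J" and b: "b \<notin> cl J"
  shows "pl_independent \<P> (insert b J)"
  unfolding pl_independent_def
proof
  have bJ: "b \<notin> J" using b pl_span_superset[of J \<P>] by blast
  fix c assume "c \<in> insert b J"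
  then consider "c = b" | "c \<in> J" "c \<noteq> b" by blast
  then show "c \<notin> cl (insert b J - {c})"
  proof cases
    case 1 then show ?thesis using b bJ by simp
  next
    case 2
    show ?thesis
    proof
      assume "c \<in> cl (insert b J - {c})"
      moreover have "insert b J - {c} = insert b (J - {c})" using 2 by blast
      ultimately have "c \<in> cl (insert b (J - {c}))" by simp
      moreover have "c \<notin> cl (J - {c})" using ind 2 by (simp add: pl_independent_def)
      ultimately have "b \<in> cl (insert c (J - {c}))"
        using span_exchange[OF V _ J(2), of "J - {c}" c] J(1) by blast
      then show False using b 2 by (simp add: insert_absorb)
    qed
  qed
qed

lemma independent_subset:
  assumes "pl_independent \<P> J" "I \<subseteq> J" shows "pl_independent \<P> I"
  unfolding pl_independent_def
proof
  fix b assume b: "b \<in> I"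
  have "cl (I - {b}) \<subseteq> cl (J - {b})" using assms(2) by (intro pl_span_mono) blast
  then show "b \<notin> cl (I - {b})" using assms b by (auto simp: pl_independent_def)
qed

text \<open>Steinitz replacement, by induction on the number of elements of \<open>I\<close> outside
  \<open>B\<close>: such an \<open>a\<close> is replaced by some \<open>b\<close> in
  \<open>B\<close> outside the span of the rest, which preserves independence and size.\<close>

lemma steinitz:
  assumes V: "sing V" and B: "B \<subseteq> V" "finite B"
  shows "finite I \<Longrightarrow> I \<subseteq> cl B \<Longrightarrow> pl_independent \<P> I \<Longrightarrow> card I \<le> card B"
proof (induction "card (I - B)" arbitrary: I rule: less_induct)
  case less
  have clV: "cl B \<subseteq> V" using pl_span_least[OF sing_subspace[OF V] B(1)] .
  show ?case
  proof (cases "I \<subseteq> B")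
    case True then show ?thesis using B by (simp add: card_mono)
  next
    case False
    then obtain a where a: "a \<in> I" "a \<notin> B" by blast
    let ?J = "I - {a}"
    have aJ: "a \<notin> cl ?J" using less(4) a by (simp add: pl_independent_def)
    have "\<not> B \<subseteq> cl ?J"
    proof
      assume "B \<subseteq> cl ?J"
      then have "cl B \<subseteq> cl ?J" using pl_span_mono[of B "cl ?J" \<P>] by (simp add: pl_span_idem)
      then show False using aJ a less(3) by blast
    qed
    then obtain b where b: "b \<in> B" "b \<notin> cl ?J" by blast
    then have bJ: "b \<notin> ?J" using pl_span_superset[of ?J \<P>] by blast
    have "insert b ?J - B \<subset> I - B" using a b(1) by auto
    then have "card (insert b ?J - B) < card (I - B)"
      using less(2) by (simp add: psubset_card_mono)
    moreover have "insert b ?J \<subseteq> cl B" using b less(3) pl_span_superset[of B \<P>] by blast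
    moreover have "pl_independent \<P> (insert b ?J)"
    proof (rule independent_insert[OF V _ _ _ b(2)])
      show "?J \<subseteq> V" "b \<in> V" using clV less(3) b B by auto
      show "pl_independent \<P> ?J" using independent_subset[OF less(4)] by blast
    qed
    moreover have fin: "finite (insert b ?J)" using less(2) by simp
    ultimately have "card (insert b ?J) \<le> card B" by (intro less(1))
    moreover have "card (insert b ?J) = card I"
      using bJ a less(2) card.remove[of I a] by (metis card_insert_disjoint finite_Diff)
    ultimately show ?thesis by simp
  qed
qed

section \<open>Bases and the rank of a singular subspace\<close>

definition basis :: "'a set \<Rightarrow> 'a set \<Rightarrow> bool" where
  "basis X B \<longleftrightarrow> B \<subseteq> X \<and> finite B \<and> pl_independent \<P> B \<and> cl B = X"

text \<open>For singular \<open>X\<close> the chosen basis is immaterial by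
  \<open>basis_card_eq\<close>. Counting base points keeps ranks in \<open>nat\<close>, with the
  empty subspace at 0.\<close>

definition rk :: "'a set \<Rightarrow> nat" where
  "rk X = card (SOME B. basis X B)"

lemma basis_card_eq:
  assumes "sing X" "basis X B" "basis X C" shows "card B = card C"
proof -
  have "card I \<le> card J" if "basis X I" "basis X J" for I J
    using steinitz[OF assms(1), of J I] that by (auto simp: basis_def)
  then show ?thesis using assms by (simp add: order_antisym)
qed

lemma maxsing_basis:
  assumes "maxsing V" obtains B where "basis V B" "card B = n"
proof -
  have "V \<in> grassmannian \<P> (int n - 1)"
    using rank assms by (simp add: polar_space_of_rank_def)
  then show ?thesis using that by (auto simp: grassmannian_def basis_def)
qed

lemma independent_card_le:
  assumes "sing X" "I \<subseteq> X" "finite I" "pl_independent \<P> I" shows "card I \<le> n"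
proof -
  obtain V where V: "maxsing V" "X \<subseteq> V" using sing_in_maxsing[OF assms(1)] .
  obtain B where B: "basis V B" "card B = n" using maxsing_basis[OF V(1)] .
  show ?thesis
    using steinitz[OF maxsing_sing[OF V(1)], of B I] B assms V by (auto simp: basis_def)
qed

text \<open>An independent set between \<open>I\<close> and \<open>X\<close> of the largest size,
  which exists by the bound \<open>n\<close>, must span \<open>X\<close>: any point outside its span
  could be adjoined.\<close>

lemma independent_extend:
  assumes X: "sing X" and I: "I \<subseteq> X" "finite I" "pl_independent \<P> I"
  obtains B where "basis X B" "I \<subseteq> B"
proof -
  let ?P = "\<lambda>J. I \<subseteq> J \<and> J \<subseteq> X \<and> finite J \<and> pl_independent \<P> J"
  have "?P I" using I by simp
  moreover have "\<forall>J. ?P J \<longrightarrow> card J < Suc n"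
    using independent_card_le[OF X] by (simp add: less_Suc_eq_le)
  ultimately have "\<exists>J. ?P J \<and> (\<forall>J'. ?P J' \<longrightarrow> card J' \<le> card J)"
    by (rule ex_has_greatest_nat[where P = ?P and f = card])
  then obtain J where J: "?P J" and Jmax: "\<And>J'. ?P J' \<Longrightarrow> card J' \<le> card J" by (elim exE conjE) simp
  have "cl J = X"
  proof (rule ccontr)
    assume "cl J \<noteq> X"
    moreover have "cl J \<subseteq> X" using pl_span_least[OF sing_subspace[OF X]] J by blast
    ultimately obtain x where x: "x \<in> X" "x \<notin> cl J" by blast
    then have "x \<notin> J" using pl_span_superset[of J \<P>] by blast
    moreover have "?P (insert x J)"
      using J x independent_insert[OF X _ x(1) _ x(2)] by (simp add: subset_insertI2)
    then have "card (insert x J) \<le> card J" by (rule Jmax)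
    ultimately show False using J by simp
  qed
  then have "basis X J" using J by (simp add: basis_def)
  then show ?thesis using J that by blast
qed

lemma basis_exists:
  assumes "sing X" obtains B where "basis X B"
  using independent_extend[OF assms, of "{}"] by (auto simp: pl_independent_def)

lemma rk_basis:
  assumes "sing X" "basis X B" shows "rk X = card B"
  unfolding rk_def
proof (rule basis_card_eq[OF assms(1) _ assms(2)])
  show "basis X (SOME B. basis X B)" using assms(2) by (rule someI)
qed

lemma grassmannian_iff: "X \<in> grassmannian \<P> k \<longleftrightarrow> sing X \<and> int (rk X) = k + 1"
proof
  assume "X \<in> grassmannian \<P> k"
  then obtain B where "sing X" "basis X B" "int (card B) = k + 1"
    by (auto simp: grassmannian_def basis_def)
  then show "sing X \<and> int (rk X) = k + 1" using rk_basis by simp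
next
  assume X: "sing X \<and> int (rk X) = k + 1"
  then obtain B where "basis X B" using basis_exists by blast
  then show "X \<in> grassmannian \<P> k"
    using X rk_basis[of X B] by (auto simp: grassmannian_def basis_def)
qed

lemma rk_mono:
  assumes "sing X" "sing Y" "X \<subseteq> Y" shows "rk X \<le> rk Y"
proof -
  obtain B where B: "basis X B" using basis_exists[OF assms(1)] .
  obtain C where C: "basis Y C" "B \<subseteq> C"
    using independent_extend[OF assms(2), of B] B assms(3) by (auto simp: basis_def)
  then show ?thesis
    using rk_basis[OF assms(1) B] rk_basis[OF assms(2) C(1)] by (simp add: basis_def card_mono)
qed

text \<open>A basis of \<open>X\<close> extends to a basis of \<open>Y\<close>, and the rank bound
  leaves no room for a further element.\<close>

lemma rk_eq:
  assumes "sing X" "sing Y" "X \<subseteq> Y" "rk Y \<le> rk X" shows "X = Y"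
proof -
  obtain B where B: "basis X B" using basis_exists[OF assms(1)] .
  obtain C where C: "basis Y C" "B \<subseteq> C"
    using independent_extend[OF assms(2), of B] B assms(3) by (auto simp: basis_def)
  then have "card C \<le> card B"
    using rk_basis[OF assms(1) B] rk_basis[OF assms(2) C(1)] assms(4) by simp
  then have "B = C" using C by (intro card_seteq) (auto simp: basis_def)
  then show ?thesis using B C by (simp add: basis_def)
qed

lemma rk_less:
  assumes "sing X" "sing Y" "X \<subseteq> Y" "y \<in> Y" "y \<notin> X" shows "rk X < rk Y"
  using rk_eq[OF assms(1-3)] assms(4,5) by (auto simp: not_le[symmetric])

lemma rk_le: "sing X \<Longrightarrow> rk X \<le> n"
  using basis_exists[of X] rk_basis[of X] independent_card_le[of X] by (metis basis_def)

lemma rk_insert: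
  assumes X: "sing X" and x: "x \<in> perp X" "x \<notin> X"
  shows "rk (cl (insert x X)) = Suc (rk X)"
proof -
  obtain B where B: "basis X B" using basis_exists[OF X] .
  have s: "sing (cl (insert x X))" using sing_span_insert[OF X x(1)] .
  have sup: "insert x X \<subseteq> cl (insert x X)" by (rule pl_span_superset)
  have "cl (insert x B) = cl (insert x X)"
    using B pl_span_insert_span[of \<P> x B] by (simp add: basis_def)
  moreover have "pl_independent \<P> (insert x B)"
    using independent_insert[OF s, of B x] B sup x by (auto simp: basis_def)
  ultimately have "basis (cl (insert x X)) (insert x B)"
    using B sup by (auto simp: basis_def)
  then have "rk (cl (insert x X)) = card (insert x B)" by (rule rk_basis[OF s])
  moreover have "x \<notin> B" "finite B" using x B by (auto simp: basis_def)
  ultimately show ?thesis using rk_basis[OF X B] by simp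
qed

text \<open>The rank hypothesis gives the forward direction. Conversely no singular subspace has
  rank above \<open>n\<close>, so \<open>rk_eq\<close> excludes a proper extension.\<close>

lemma maxsing_iff: "maxsing V \<longleftrightarrow> sing V \<and> rk V = n"
proof
  assume V: "maxsing V"
  then show "sing V \<and> rk V = n"
    using maxsing_basis[OF V] rk_basis maxsing_sing by metis
next
  assume V: "sing V \<and> rk V = n"
  have "Y = V" if "sing Y" "V \<subseteq> Y" for Y
    using rk_eq[of V Y] V that rk_le[of Y] by simp
  then show "maxsing V" using V by (simp add: maximal_singular_def)
qed

lemma rk_empty: "rk {} = 0"
proof -
  have "cl {} = {}" by (rule pl_span_of_subspace[OF sing_subspace[OF sing_empty]])
  then have "basis {} {}" by (simp add: basis_def pl_independent_def)
  then show ?thesis using rk_basis[OF sing_empty] by simp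
qed

lemma rk_singleton: "p \<in> points \<P> \<Longrightarrow> rk {p} = 1"
  using rk_insert[OF sing_empty, of p] pl_span_of_subspace[OF sing_subspace[OF sing_singleton]]
  by (simp add: rk_empty perp_def)

lemma span_insert_subset: "sing Y \<Longrightarrow> X \<subseteq> Y \<Longrightarrow> x \<in> Y \<Longrightarrow> cl (insert x X) \<subseteq> Y"
  by (intro pl_span_least) (simp_all add: sing_subspace)

section \<open>Hyperplanes and dimension inequalities\<close>

lemma hyperplane_span:
  assumes "sing V" "sing H" "H \<subseteq> V" "rk V \<le> Suc (rk H)" "x \<in> V" "x \<notin> H"
  shows "cl (insert x H) = V"
proof -
  have x: "x \<in> perp H" using sing_perp[OF assms(1,3)] assms(5) by (rule subsetD)
  show ?thesis
    using rk_eq[OF sing_span_insert[OF assms(2) x] assms(1) span_insert_subset[OF assms(1,3,5)]]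
      rk_insert[OF assms(2) x assms(6)] assms(4) by simp
qed

text \<open>\<open>H\<close> has the largest rank among the singular subspaces between
  \<open>A\<close> and \<open>V\<close> that miss \<open>x\<close>. Adjoining any other
  \<open>y\<close> of \<open>V\<close> must capture \<open>x\<close>, so by exchange
  \<open>y\<close> lies in the span of \<open>H\<close> and \<open>x\<close>; this span is therefore
  \<open>V\<close>.\<close>

lemma hyperplane_avoiding:
  assumes V: "sing V" and A: "sing A" "A \<subseteq> V" and x: "x \<in> V" "x \<notin> A"
  obtains H where "sing H" "A \<subseteq> H" "H \<subseteq> V" "x \<notin> H" "rk V = Suc (rk H)"
proof -
  let ?P = "\<lambda>H. sing H \<and> A \<subseteq> H \<and> H \<subseteq> V \<and> x \<notin> H"
  have "?P A" using A x by simp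
  moreover have "\<forall>H. ?P H \<longrightarrow> rk H < Suc n"
    using rk_le by (simp add: less_Suc_eq_le)
  ultimately have "\<exists>H. ?P H \<and> (\<forall>H'. ?P H' \<longrightarrow> rk H' \<le> rk H)"
    by (rule ex_has_greatest_nat[where P = ?P and f = rk])
  then obtain H where H: "sing H" "A \<subseteq> H" "H \<subseteq> V" "x \<notin> H"
    and Hmax: "\<And>H'. ?P H' \<Longrightarrow> rk H' \<le> rk H" by (elim exE conjE) simp
  have xH: "x \<in> perp H" using sing_perp[OF V H(3)] x(1) by (rule subsetD)
  have "V \<subseteq> cl (insert x H)"
  proof
    fix y assume y: "y \<in> V"
    show "y \<in> cl (insert x H)"
    proof (cases "y \<in> H")
      case True then show ?thesis using pl_span_superset[of "insert x H" \<P>] by auto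
    next
      case False
      have yH: "y \<in> perp H" using sing_perp[OF V H(3)] y by (rule subsetD)
      let ?Y = "cl (insert y H)"
      have "sing ?Y" using sing_span_insert[OF H(1) yH] .
      moreover have "A \<subseteq> ?Y" using pl_span_superset[of "insert y H" \<P>] H(2) by auto
      moreover have "?Y \<subseteq> V" using span_insert_subset[OF V H(3) y] .
      moreover have "rk ?Y = Suc (rk H)" using rk_insert[OF H(1) yH False] .
      ultimately have "x \<in> ?Y" using Hmax[of ?Y] by auto
      moreover have "x \<notin> cl H" using H by (simp add: pl_span_of_subspace sing_subspace)
      ultimately show ?thesis using span_exchange[OF V H(3) y] by simp
    qed
  qed
  then have "cl (insert x H) = V" using span_insert_subset[OF V H(3) x(1)] by simp
  then have "rk V = Suc (rk H)" using rk_insert[OF H(1) xH H(4)] by simp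
  then show ?thesis using that H by simp
qed

text \<open>For \<open>x\<close> in \<open>X\<close> outside \<open>H\<close>, the line from
  \<open>x\<close> to any other point of \<open>X\<close> meets \<open>H\<close>, in a point that
  again lies in \<open>X\<close>. So \<open>x\<close> and \<open>X \<inter> H\<close> span
  \<open>X\<close>.\<close>

lemma rk_Int_hyperplane:
  assumes V: "sing V" and H: "sing H" "H \<subseteq> V" "rk V \<le> Suc (rk H)" and X: "sing X" "X \<subseteq> V"
  shows "rk X \<le> Suc (rk (X \<inter> H))"
proof (cases "X \<subseteq> H")
  case True then show ?thesis by (simp add: Int_absorb2)
next
  case False
  then obtain x where x: "x \<in> X" "x \<notin> H" by auto
  let ?Y = "X \<inter> H"
  have sY: "sing ?Y" using sing_Int'[OF X(1) H(1)] .
  have xY: "x \<in> perp ?Y" using sing_perp[OF X(1), of ?Y] x(1) by auto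
  have xH: "x \<in> perp H" using sing_perp[OF V H(2)] x(1) X(2) by auto
  have span: "cl (insert x H) = V" using hyperplane_span[OF V H] x X(2) by auto
  have sup: "insert x ?Y \<subseteq> cl (insert x ?Y)" by (rule pl_span_superset)
  have "X \<subseteq> cl (insert x ?Y)"
  proof
    fix y assume y: "y \<in> X"
    show "y \<in> cl (insert x ?Y)"
    proof (cases "y = x")
      case True then show ?thesis using sup by simp
    next
      case False
      have "y \<in> cl (insert x H)" using span y X(2) by auto
      from span_insertE[OF H(1) xH this False] obtain l h
        where l: "l \<in> lines \<P>" "x \<in> l" "y \<in> l" "h \<in> l" "h \<in> H" "h \<noteq> x" .
      have "h \<in> X"
        using subspace_line[OF sing_subspace[OF X(1)] l(1,2,3) x(1) y _ l(4)] False by simp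
      then have "h \<in> cl (insert x ?Y)" "x \<in> cl (insert x ?Y)" using l(5) sup by auto
      then show ?thesis
        using subspace_line[OF sing_subspace[OF sing_span_insert[OF sY xY]] l(1,4,2) _ _ l(6,3)] by simp
    qed
  qed
  then have "rk X \<le> rk (cl (insert x ?Y))"
    by (rule rk_mono[OF X(1) sing_span_insert[OF sY xY]])
  also have "\<dots> = Suc (rk ?Y)" using rk_insert[OF sY xY] x by simp
  finally show ?thesis .
qed

text \<open>One half of the dimension formula, with \<open>U\<close> in place of the join. Enlarging
  \<open>B\<close> by single points up to \<open>U\<close> raises \<open>rk B\<close> by one and
  \<open>rk (A \<inter> B)\<close> by at most one each time.\<close>

lemma rk_modular:
  assumes U: "sing U" and A: "sing A" "A \<subseteq> U" and B: "sing B" "B \<subseteq> U"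
  shows "rk A + rk B \<le> rk U + rk (A \<inter> B)"
  using B
proof (induction "rk U - rk B" arbitrary: B rule: less_induct)
  case less
  show ?case
  proof (cases "B = U")
    case True then show ?thesis using A by (simp add: Int_absorb2)
  next
    case False
    then obtain y where y: "y \<in> U" "y \<notin> B" using less(3) by auto
    have yB: "y \<in> perp B" using sing_perp[OF U less(3)] y(1) by (rule subsetD)
    let ?C = "cl (insert y B)"
    have C: "sing ?C" "?C \<subseteq> U" "rk ?C = Suc (rk B)" "B \<subseteq> ?C"
      using sing_span_insert[OF less(2) yB] span_insert_subset[OF U less(3) y(1)]
        rk_insert[OF less(2) yB y(2)] pl_span_superset[of "insert y B" \<P>] by auto
    have "rk ?C \<le> rk U" using rk_mono[OF C(1) U C(2)] .
    then have "rk A + rk ?C \<le> rk U + rk (A \<inter> ?C)" using less(1)[OF _ C(1,2)] C(3) by simp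
    moreover have "rk (A \<inter> ?C) \<le> Suc (rk (A \<inter> ?C \<inter> B))"
      using rk_Int_hyperplane[OF C(1) less(2) C(4) _ sing_Int'[OF A(1) C(1)]] C(3) by simp
    moreover have "A \<inter> ?C \<inter> B = A \<inter> B" using C(4) by auto
    ultimately show ?thesis using C(3) by simp
  qed
qed

section \<open>Ranks of perps\<close>

lemma perp_span:
  assumes "A \<subseteq> points \<P>" shows "perp (cl A) = perp A"
proof
  show "perp (cl A) \<subseteq> perp A" using pl_span_superset[of A \<P>] by (auto simp: perp_def)
  show "perp A \<subseteq> perp (cl A)"
  proof
    fix q assume q: "q \<in> perp A"
    then have "A \<subseteq> perp {q}" using perp_swap[OF assms, of "{q}"] by simp
    then have "cl A \<subseteq> perp {q}" by (rule pl_span_least[OF subspace_perp])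
    then show "q \<in> perp (cl A)"
      using perp_swap[of "{q}" "cl A"] q by (simp add: perp_def)
  qed
qed

text \<open>By the one-or-all axiom every line of \<open>X\<close> meets \<open>perp {p}\<close>, so
  the argument of \<open>rk_Int_hyperplane\<close> applies with \<open>perp {p}\<close> as
  hyperplane.\<close>

lemma rk_perp_point:
  assumes X: "sing X" and p: "p \<in> points \<P>"
  shows "rk X \<le> Suc (rk (X \<inter> perp {p}))"
proof (cases "X \<subseteq> perp {p}")
  case True then show ?thesis by (simp add: Int_absorb2)
next
  case False
  then obtain x where x: "x \<in> X" "x \<notin> perp {p}" by auto
  let ?Y = "X \<inter> perp {p}"
  have sY: "sing ?Y" using sing_Int[OF X subspace_perp] .
  have xY: "x \<in> perp ?Y" using sing_perp[OF X, of ?Y] x(1) by auto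
  have sup: "insert x ?Y \<subseteq> cl (insert x ?Y)" by (rule pl_span_superset)
  have "X \<subseteq> cl (insert x ?Y)"
  proof
    fix y assume y: "y \<in> X"
    show "y \<in> cl (insert x ?Y)"
    proof (cases "y = x")
      case True then show ?thesis using sup by simp
    next
      case False
      obtain l where l: "l \<in> lines \<P>" "x \<in> l" "y \<in> l"
        using coll_lineE[OF sing_coll[OF X x(1) y]] False by metis
      obtain q where q: "q \<in> l" "p \<sim> q" using line_one[OF l(1) p] .
      have "q \<in> X"
        using subspace_line[OF sing_subspace[OF X] l x(1) y _ q(1)] False by simp
      moreover have qp: "q \<in> perp {p}" using q line_points[OF l(1) q(1)] by (simp add: perp_def coll_commute)
      ultimately have "q \<in> cl (insert x ?Y)" "x \<in> cl (insert x ?Y)" using sup by auto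
      moreover have "q \<noteq> x" using x qp by auto
      ultimately show ?thesis
        using subspace_line[OF sing_subspace[OF sing_span_insert[OF sY xY]] l(1) q(1) l(2) _ _ _ l(3)] by simp
    qed
  qed
  then have "rk X \<le> rk (cl (insert x ?Y))"
    by (rule rk_mono[OF X sing_span_insert[OF sY xY]])
  also have "\<dots> = Suc (rk ?Y)" using rk_insert[OF sY xY] x by simp
  finally show ?thesis .
qed

text \<open>The points of \<open>A \<inter> X\<close> cost \<open>X\<close> nothing, because
  \<open>X\<close> is singular. Passing from a hyperplane \<open>H\<close> of \<open>A\<close> that
  contains \<open>A \<inter> X\<close> to \<open>A\<close> adds one point, which costs at most one
  rank.\<close>

lemma rk_perp:
  assumes X: "sing X" and A: "sing A"
  shows "rk X + rk (A \<inter> X) \<le> rk (X \<inter> perp A) + rk A"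
  using A
proof (induction "rk A" arbitrary: A rule: less_induct)
  case less
  show ?case
  proof (cases "A \<subseteq> X")
    case True
    then have "X \<inter> perp A = X" using sing_perp[OF X True] by auto
    then show ?thesis using True by (simp add: Int_absorb2)
  next
    case False
    then obtain x where x: "x \<in> A" "x \<notin> A \<inter> X" by auto
    obtain H where H: "sing H" "A \<inter> X \<subseteq> H" "H \<subseteq> A" "x \<notin> H" "rk A = Suc (rk H)"
      using hyperplane_avoiding[OF less(2) sing_Int'[OF less(2) X] _ x] by auto
    have HX: "H \<inter> X = A \<inter> X" using H by auto
    have "cl (insert x H) = A" using hyperplane_span[OF less(2) H(1,3) _ x(1) H(4)] H(5) by simp
    moreover have xp: "x \<in> points \<P>" "H \<subseteq> points \<P>"
      using x(1) sing_points[OF less(2)] sing_points[OF H(1)] by auto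
    ultimately have "perp A = perp (insert x H)" using perp_span[of "insert x H"] by simp
    then have eq: "X \<inter> perp A = X \<inter> perp H \<inter> perp {x}" by (auto simp: perp_def)
    have "rk X + rk (H \<inter> X) \<le> rk (X \<inter> perp H) + rk H" using less(1)[OF _ H(1)] H(5) by simp
    moreover have "rk (X \<inter> perp H) \<le> Suc (rk (X \<inter> perp H \<inter> perp {x}))"
      using rk_perp_point[OF sing_Int[OF X subspace_perp] xp(1)] .
    ultimately show ?thesis using eq HX H(5) by simp
  qed
qed

lemma maxsing_span:
  assumes "sing H" "Suc (rk H) = n" "x \<in> perp H" "x \<notin> H"
  shows "maxsing (cl (insert x H))"
  using rk_insert[OF assms(1,3,4)] sing_span_insert[OF assms(1,3)] assms(2) by (simp add: maxsing_iff)

text \<open>The rank drops by at most one by \<open>rk_perp_point\<close>, and it does drop: if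
  \<open>p\<close> were collinear with all of \<open>V\<close>, it would belong to
  \<open>V\<close>.\<close>

lemma perp_hyperplane:
  assumes V: "maxsing V" and p: "p \<in> points \<P>" "p \<notin> V"
  shows "sing (V \<inter> perp {p})" "Suc (rk (V \<inter> perp {p})) = n" "p \<in> perp (V \<inter> perp {p})"
proof -
  have sV: "sing V" using maxsing_sing[OF V] .
  show s: "sing (V \<inter> perp {p})" using sing_Int[OF sV subspace_perp] .
  have "V \<inter> perp {p} \<noteq> V"
  proof
    assume "V \<inter> perp {p} = V"
    then have "V \<subseteq> perp {p}" by (simp only: inf.absorb_iff1)
    then have "p \<in> perp V" using perp_swap[of "{p}" V] p by simp
    then show False using maxsing_perp[OF V] p by simp
  qed
  then have "rk (V \<inter> perp {p}) < rk V" using rk_eq[OF s sV] by (auto simp: not_le)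
  then show "Suc (rk (V \<inter> perp {p})) = n"
    using rk_perp_point[OF sV p(1)] V by (simp add: maxsing_iff)
  show "p \<in> perp (V \<inter> perp {p})" using perp_swap[of "{p}" "V \<inter> perp {p}"] p by simp
qed

lemma hyperplane_eq_perp:
  assumes V: "maxsing V" and H: "sing H" "H \<subseteq> V" "Suc (rk H) = n" and e: "e \<in> perp H" "e \<notin> V"
  shows "H = V \<inter> perp {e}"
proof (rule rk_eq[OF H(1)])
  have ep: "e \<in> points \<P>" using e by (simp add: perp_def)
  note h = perp_hyperplane[OF V ep e(2)]
  show "sing (V \<inter> perp {e})" by (rule h)
  show "H \<subseteq> V \<inter> perp {e}" using H(2) perp_swap[OF sing_points[OF H(1)], of "{e}"] e(1) by simp
  show "rk (V \<inter> perp {e}) \<le> rk H" using h(2) H(3) by simp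
qed

section \<open>Every hyperplane of a maximal singular subspace lies in another one\<close>

text \<open>The hyperplanes containing \<open>V \<inter> perp {b} \<inter> perp {c}\<close> form a
  line of the dual space of \<open>V\<close>. Once \<open>b\<close> is replaced by a point
  \<open>u\<close> with the same trace on \<open>V\<close> that is collinear with \<open>c\<close>,
  the line through \<open>u\<close> and \<open>c\<close> contains a point collinear with all of
  \<open>H\<close>.\<close>

lemma dual_line:
  assumes V: "maxsing V" and b: "b \<in> points \<P>" "b \<notin> V" and c: "c \<in> points \<P>" "c \<notin> V"
    and ne: "V \<inter> perp {b} \<noteq> V \<inter> perp {c}"
    and H: "sing H" "H \<subseteq> V" "Suc (rk H) = n" "V \<inter> perp {b} \<inter> perp {c} \<subseteq> H"
  shows "\<exists>e. e \<notin> V \<and> e \<in> perp H"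
proof -
  let ?L = "V \<inter> perp {b}" and ?M = "V \<inter> perp {c}"
  let ?K = "?L \<inter> ?M"
  have sV: "sing V" and rV: "rk V = n" using V by (simp_all add: maxsing_iff)
  note L = perp_hyperplane[OF V b] and M = perp_hyperplane[OF V c]
  have sK: "sing ?K" using sing_Int'[OF L(1) M(1)] .
  have KH: "?K \<subseteq> H" using H(4) by auto
  have LM: "\<not> ?L \<subseteq> ?M" using rk_eq[OF L(1) M(1)] L(2) M(2) ne by auto
  obtain y where "y \<in> ?L" "y \<notin> ?K" using LM by auto
  then have rKL: "rk ?K < rk ?L" by (rule rk_less[OF sK L(1) Int_lower1])
  have rLK: "rk ?L \<le> Suc (rk ?K)"
    using rk_Int_hyperplane[OF sV M(1) _ _ L(1)] M(2) rV by simp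
  let ?W = "cl (insert b ?L)"
  have "b \<notin> ?L" using b by simp
  then have W: "maxsing ?W" using maxsing_span[OF L(1,2,3)] by simp
  have sW: "sing ?W" using maxsing_sing[OF W] .
  have LW: "insert b ?L \<subseteq> ?W" by (rule pl_span_superset)
  let ?X = "?W \<inter> perp {c}"
  have sX: "sing ?X" using sing_Int[OF sW subspace_perp] .
  \<comment> \<open>A point of \<open>?X\<close> in \<open>V\<close> is collinear with
    \<open>b\<close> as well as with \<open>c\<close>, so it lies in \<open>?K\<close>, whose rank
    is too small to hold all of \<open>?X\<close>.\<close>
  have "\<not> ?X \<subseteq> V"
  proof
    assume XV: "?X \<subseteq> V"
    have "?X \<subseteq> ?K"
    proof
      fix z assume z: "z \<in> ?X"
      have "b \<in> ?W" using LW by simp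
      then have "z \<sim> b" using sing_coll[OF sW, of z b] z by simp
      then have "z \<in> perp {b}" by (simp add: perp_def coll_points)
      then show "z \<in> ?K" using z XV by auto
    qed
    then have "rk ?X \<le> rk ?K" by (rule rk_mono[OF sX sK])
    moreover have "n \<le> Suc (rk ?X)" using rk_perp_point[OF sW c(1)] W by (simp add: maxsing_iff)
    ultimately show False using rKL L(2) by simp
  qed
  then obtain u where u: "u \<in> ?W" "u \<in> perp {c}" "u \<notin> V" by auto
  have up: "u \<in> points \<P>" using u by (simp add: perp_def)
  have uL: "u \<in> perp ?L" using sing_perp[OF sW, of ?L] LW u(1) by auto
  have Lu: "?L = V \<inter> perp {u}" using hyperplane_eq_perp[OF V L(1) _ L(2) uL u(3)] by simp
  have uc: "u \<sim> c" "u \<noteq> c" using u ne Lu by (auto simp: perp_def)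
  obtain l where l: "l \<in> lines \<P>" "u \<in> l" "c \<in> l" using coll_lineE[OF uc] .
  have "\<not> H \<subseteq> ?K" using rk_mono[OF H(1) sK] rKL L(2) H(3) by auto
  then obtain h where h: "h \<in> H" "h \<notin> ?K" by auto
  have hp: "h \<in> points \<P>" using sing_points[OF H(1)] h(1) by auto
  have span: "cl (insert h ?K) = H"
    using hyperplane_span[OF H(1) sK KH _ h] rLK L(2) H(3) by simp
  \<comment> \<open>\<open>H\<close> is spanned by \<open>?K\<close> and \<open>h\<close>. Every
    point of \<open>l\<close> is collinear with \<open>?K\<close>, as \<open>u\<close> and
    \<open>c\<close> are, so collinearity with \<open>h\<close> is all that remains.\<close>
  obtain e where e: "e \<in> l" "h \<sim> e" using line_one[OF l(1) hp] .
  have "u \<in> perp ?K" "c \<in> perp ?K" using uL M(3) by (auto simp: perp_def)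
  then have "e \<in> perp ?K" using subspace_line[OF subspace_perp l _ _ uc(2) e(1)] by simp
  then have "e \<in> perp (insert h ?K)" using e by (simp add: perp_def coll_commute)
  then have "e \<in> perp (cl (insert h ?K))"
    using perp_span[of "insert h ?K"] hp sing_points[OF sK] by simp
  then have eH: "e \<in> perp H" using span by simp
  \<comment> \<open>Otherwise each point of \<open>?M\<close> would be collinear with
    \<open>e\<close> and \<open>c\<close>, hence with \<open>u\<close>, giving
    \<open>?M \<subseteq> ?L\<close>.\<close>
  have "e \<notin> V"
  proof
    assume eV: "e \<in> V"
    have ec: "e \<noteq> c" using eV c by auto
    have "?M \<subseteq> ?L"
    proof
      fix z assume z: "z \<in> ?M"
      have "z \<sim> c" using z by (simp add: perp_def)
      moreover have "z \<sim> e" using sing_coll[OF sV, of z e] z eV by simp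
      ultimately have "z \<sim> u" using line_all[OF l(1) _ _ e(1) l(3) ec l(2), of z] by simp
      then have "z \<in> V \<inter> perp {u}" using z by (simp add: perp_def)
      then show "z \<in> ?L" using Lu by simp
    qed
    then show False using rk_eq[OF M(1) L(1)] L(2) M(2) ne by auto
  qed
  with eH show ?thesis by auto
qed

text \<open>The hyperplanes of \<open>V\<close> of the form \<open>V \<inter> perp {q}\<close> are closed under dual lines, and no point
  lies in all of them; so a minimal \<open>D\<close> all of whose superhyperplanes have this form is empty.\<close>

lemma hyperplane_perp_outside:
  assumes V: "maxsing V" and H: "sing H" "H \<subseteq> V" "Suc (rk H) = n"
  shows "\<exists>e. e \<notin> V \<and> e \<in> perp H"
proof -
  have sV: "sing V" and rV: "rk V = n" using V by (simp_all add: maxsing_iff)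
  let ?hyp = "\<lambda>H. sing H \<and> H \<subseteq> V \<and> Suc (rk H) = n"
  let ?good = "\<lambda>H. \<exists>e. e \<notin> V \<and> e \<in> perp H"
  have avoid: "\<exists>q\<in>points \<P>. q \<notin> V \<and> x \<notin> perp {q}" if x: "x \<in> V" for x
  proof -
    have "x \<in> points \<P>" using x sing_points[OF sV] by auto
    then obtain q where q: "q \<in> points \<P>" "\<not> x \<sim> q" using nondegenerate by blast
    then have "q \<notin> V" using sing_coll[OF sV x, of q] by auto
    then show ?thesis using q by (auto simp: perp_def)
  qed
  have descend: "\<forall>H. ?hyp H \<longrightarrow> ?good H"
    if "sing D" "D \<subseteq> V" "\<forall>H. ?hyp H \<longrightarrow> D \<subseteq> H \<longrightarrow> ?good H" for D
    using that
  proof (induction "rk D" arbitrary: D rule: less_induct)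
    case less
    show ?case
    proof (cases "D = {}")
      case True then show ?thesis using less(4) by simp
    next
      case False
      then obtain x where x: "x \<in> D" by auto
      then have xV: "x \<in> V" using less(3) by auto
      obtain q where q: "q \<in> points \<P>" "q \<notin> V" "x \<notin> perp {q}" using avoid[OF xV] by auto
      let ?L = "V \<inter> perp {q}"
      note L = perp_hyperplane[OF V q(1,2)]
      let ?D = "D \<inter> ?L"
      have sD: "sing ?D" using sing_Int'[OF less(2) L(1)] .
      have "rk ?D < rk D" using rk_less[OF sD less(2) Int_lower1 x] q by simp
      moreover have "rk D \<le> Suc (rk ?D)"
        using rk_Int_hyperplane[OF sV L(1) _ _ less(2,3)] L(2) rV by simp
      then have spanD: "cl (insert x ?D) = D"
        using hyperplane_span[OF less(2) sD _ _ x] q by simp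
      moreover have "?good H" if H: "?hyp H" "?D \<subseteq> H" for H
      proof (cases "D \<subseteq> H \<or> H = ?L")
        case True then show ?thesis using less(4) H L(3) q by auto
      next
        case F: False
        have sH: "sing H" "H \<subseteq> V" "Suc (rk H) = n" using H by simp_all
        let ?K = "?L \<inter> H"
        have sK: "sing ?K" using sing_Int'[OF L(1) sH(1)] .
        have "rk ?L \<le> Suc (rk ?K)" using rk_Int_hyperplane[OF sV sH(1,2) _ L(1)] sH(3) rV by simp
        moreover have "\<not> ?L \<subseteq> H" using rk_eq[OF L(1) sH(1)] L(2) sH(3) F by auto
        then obtain y where "y \<in> ?L" "y \<notin> ?K" by auto
        then have "rk ?K < rk ?L" by (rule rk_less[OF sK L(1) Int_lower1])
        ultimately have rK: "Suc (Suc (rk ?K)) = n" using L(2) by simp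
        \<comment> \<open>\<open>D\<close> is spanned by \<open>x\<close> and \<open>?D\<close>, so
          \<open>?N\<close> contains \<open>D\<close> and already has the required form.
          \<open>H\<close> contains \<open>?K = ?N \<inter> ?L\<close>, so it lies on the dual line
          of \<open>?N\<close> and \<open>?L\<close>.\<close>
        let ?N = "cl (insert x ?K)"
        have xK: "x \<in> perp ?K" using sing_perp[OF sV, of ?K] xV by auto
        have KN: "insert x ?K \<subseteq> ?N" by (rule pl_span_superset)
        have N: "sing ?N" "?N \<subseteq> V" "Suc (rk ?N) = n"
          using sing_span_insert[OF sK xK] span_insert_subset[OF sV _ xV, of ?K] rk_insert[OF sK xK] rK q(3)
          by auto
        have "cl (insert x ?D) \<subseteq> ?N" using H(2) by (intro pl_span_mono) auto
        then have DN: "D \<subseteq> ?N" using spanD by simp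
        obtain e where e: "e \<notin> V" "e \<in> perp ?N" using less(4) N DN by auto
        have ep: "e \<in> points \<P>" using e by (simp add: perp_def)
        have Ne: "?N = V \<inter> perp {e}" using hyperplane_eq_perp[OF V N e(2,1)] .
        have NL: "?N \<noteq> ?L" using KN q by auto
        have sNL: "sing (?N \<inter> ?L)" using sing_Int'[OF N(1) L(1)] .
        have "rk (?N \<inter> ?L) < rk ?N" using rk_less[OF sNL N(1) Int_lower1, of x] KN q by simp
        then have "?K = ?N \<inter> ?L" using rk_eq[OF sK sNL] KN rK N(3) by auto
        then have "V \<inter> perp {e} \<inter> perp {q} \<subseteq> H" using Ne by auto
        then show ?thesis using dual_line[OF V ep e(1) q(1,2) _ sH] NL Ne by simp
      qed
      ultimately show ?thesis using less(1)[OF _ sD] less(3) by auto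
    qed
  qed
  have "V \<noteq> {}" using rV rk_empty rank by (auto simp: polar_space_of_rank_def)
  then obtain x where x: "x \<in> V" by auto
  obtain q where q: "q \<in> points \<P>" "q \<notin> V" using avoid[OF x] by auto
  note L = perp_hyperplane[OF V q]
  \<comment> \<open>The descent starts at the hyperplane \<open>V \<inter> perp {q}\<close>, whose
    only superhyperplane is itself, with witness \<open>q\<close>.\<close>
  have "?good H" if "?hyp H" "V \<inter> perp {q} \<subseteq> H" for H
    using rk_eq[OF L(1), of H] that L q by auto
  then have "\<forall>H. ?hyp H \<longrightarrow> ?good H" using descend[OF L(1)] by auto
  then show ?thesis using H by auto
qed

lemma other_maxsing:
  assumes V: "maxsing V" and H: "sing H" "H \<subseteq> V" "Suc (rk H) = n"
  obtains W where "maxsing W" "H \<subseteq> W" "W \<noteq> V"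
proof -
  obtain e where e: "e \<notin> V" "e \<in> perp H" using hyperplane_perp_outside[OF assms] by auto
  have "maxsing (cl (insert e H))" using maxsing_span[OF H(1,3) e(2)] e H by auto
  moreover have "insert e H \<subseteq> cl (insert e H)" by (rule pl_span_superset)
  ultimately show ?thesis using that[of "cl (insert e H)"] e by auto
qed

section \<open>The dual polar graph\<close>

lemma maxsing_subset_eq: "maxsing V \<Longrightarrow> maxsing W \<Longrightarrow> V \<subseteq> W \<Longrightarrow> V = W"
  using rk_eq[of V W] by (simp add: maxsing_iff)

lemma maxsing_Int:
  assumes V: "maxsing V" "maxsing W" "V \<noteq> W" and H: "sing H" "H \<subseteq> V" "H \<subseteq> W" "Suc (rk H) = n"
  shows "V \<inter> W = H"
proof -
  have s: "sing V" "sing W" "sing (V \<inter> W)" using V maxsing_sing sing_Int' by auto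
  obtain x where "x \<in> V" "x \<notin> V \<inter> W" using maxsing_subset_eq[OF V(1,2)] V(3) by auto
  then have "rk (V \<inter> W) < rk V" by (rule rk_less[OF s(3,1) Int_lower1])
  then show ?thesis using rk_eq[OF H(1) s(3)] H V(1) by (simp add: maxsing_iff)
qed

text \<open>By \<open>rk_perp\<close> some \<open>y\<close> in \<open>S\<close> outside
  \<open>H\<close> is collinear with all of \<open>H\<close>. The maximal singular subspaces on
  \<open>H\<close> form a line of the dual polar space, and the span \<open>V\<close> of
  \<open>H\<close> and \<open>y\<close> is its gate, the member nearest to \<open>S\<close>.\<close>

lemma gate_exists:
  assumes S: "maxsing S" and H: "sing H" "Suc (rk H) = n"
  obtains V y where "maxsing V" "H \<subseteq> V" "y \<in> V" "y \<in> S" "y \<notin> H"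
proof -
  have sS: "sing S" "rk S = n" using S by (simp_all add: maxsing_iff)
  have "rk (H \<inter> S) < rk (S \<inter> perp H)" using rk_perp[OF sS(1) H(1)] sS H(2) by simp
  then have "\<not> S \<inter> perp H \<subseteq> H \<inter> S"
    using rk_mono[OF sing_Int[OF sS(1) subspace_perp[of H]] sing_Int'[OF H(1) sS(1)]] by linarith
  then obtain y where y: "y \<in> S" "y \<in> perp H" "y \<notin> H" by auto
  have "maxsing (cl (insert y H))" using maxsing_span[OF H y(2,3)] .
  moreover have "insert y H \<subseteq> cl (insert y H)" by (rule pl_span_superset)
  ultimately show ?thesis using that[of "cl (insert y H)" y] y by simp
qed

text \<open>A common point of \<open>W\<close> and \<open>S\<close> is collinear with
  \<open>H\<close> inside \<open>W\<close> and with \<open>y\<close> inside \<open>S\<close>, hence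
  with all of \<open>V\<close>; so it lies in \<open>V \<inter> W = H\<close>.\<close>

lemma gate_unique:
  assumes V: "maxsing V" "H \<subseteq> V" "y \<in> V" and W: "maxsing W" "H \<subseteq> W" "V \<noteq> W"
    and S: "maxsing S" "y \<in> S" and H: "sing H" "Suc (rk H) = n" "y \<notin> H"
  shows "W \<inter> S = H \<inter> S"
proof -
  have s: "sing V" "sing W" "sing S" "rk V = n" "rk W = n" using V W S by (simp_all add: maxsing_iff)
  have VW: "V \<inter> W = H" using maxsing_Int[OF V(1) W(1,3) H(1) V(2) W(2) H(2)] .
  have span: "cl (insert y H) = V" using hyperplane_span[OF s(1) H(1) V(2) _ V(3) H(3)] s(4) H(2) by simp
  have yp: "y \<in> points \<P>" using sing_points[OF s(1)] V(3) by auto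
  have "z \<in> H" if z: "z \<in> W" "z \<in> S" for z
  proof -
    have "z \<in> perp H" using sing_perp[OF s(2) W(2)] z(1) by auto
    moreover have "z \<sim> y" using sing_coll[OF s(3) z(2) S(2)] .
    ultimately have "z \<in> perp (insert y H)" by (simp add: perp_def)
    then have "z \<in> perp V" using perp_span[of "insert y H"] yp sing_points[OF H(1)] span by simp
    then have "z \<in> V" by (rule maxsing_perp[OF V(1)])
    then show ?thesis using VW z by auto
  qed
  then show ?thesis using W(2) by auto
qed

text \<open>\<open>V\<close> is chosen with \<open>V \<inter> U\<close> of least rank. If
  \<open>V \<inter> U\<close> had a point \<open>x\<close> outside \<open>A\<close>, a second
  maximal singular subspace on a hyperplane of \<open>V\<close> that contains \<open>A\<close> and
  misses \<open>x\<close> would meet \<open>U\<close> in less, by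
  \<open>gate_unique\<close>.\<close>

lemma complement_exists:
  assumes U: "maxsing U" and A: "sing A"
  obtains V where "maxsing V" "A \<subseteq> V" "V \<inter> U = A \<inter> U"
proof -
  let ?P = "\<lambda>V. maxsing V \<and> A \<subseteq> V"
  obtain V0 where "maxsing V0" "A \<subseteq> V0" using sing_in_maxsing[OF A] .
  then have "?P V0" by simp
  then have "\<exists>V. ?P V \<and> (\<forall>W. ?P W \<longrightarrow> rk (V \<inter> U) \<le> rk (W \<inter> U))"
    by (rule ex_has_least_nat[where P = ?P])
  then obtain V where V: "maxsing V" "A \<subseteq> V" and least: "\<And>W. ?P W \<Longrightarrow> rk (V \<inter> U) \<le> rk (W \<inter> U)"
    by (elim exE conjE) simp
  have s: "sing V" "sing U" using V U by (simp_all add: maxsing_sing)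
  have "V \<inter> U \<subseteq> A"
  proof (rule ccontr)
    assume "\<not> V \<inter> U \<subseteq> A"
    then obtain x where x: "x \<in> V" "x \<in> U" "x \<notin> A" by auto
    obtain H where H: "sing H" "A \<subseteq> H" "H \<subseteq> V" "x \<notin> H" "rk V = Suc (rk H)"
      using hyperplane_avoiding[OF s(1) A V(2) x(1,3)] .
    have rH: "Suc (rk H) = n" using H(5) V(1) by (simp add: maxsing_iff)
    obtain W where W: "maxsing W" "H \<subseteq> W" "W \<noteq> V" using other_maxsing[OF V(1) H(1,3) rH] .
    have "W \<inter> U = H \<inter> U"
      using gate_unique[OF V(1) H(3) x(1) W(1,2) _ U x(2) H(1) rH H(4)] W(3) by simp
    moreover have "rk (H \<inter> U) < rk (V \<inter> U)"
      by (rule rk_less[OF sing_Int'[OF H(1) s(2)] sing_Int'[OF s], of x]) (use H x in auto)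
    ultimately show False using least[of W] W H(2) by auto
  qed
  then show ?thesis using that[of V] V by auto
qed

text \<open>\<open>U'\<close> is spanned by a point \<open>p\<close> of \<open>W\<close> outside
  \<open>U\<close> and the hyperplane \<open>U \<inter> perp {p}\<close>, which contains
  \<open>U \<inter> W\<close>.\<close>

lemma step_towards:
  assumes U: "maxsing U" and W: "maxsing W" "U \<noteq> W"
  obtains U' where "maxsing U'" "Suc (rk (U \<inter> U')) = n" "U \<inter> W \<subseteq> U'" "rk (U \<inter> W) < rk (U' \<inter> W)"
proof -
  have s: "sing U" "sing W" using U W by (simp_all add: maxsing_sing)
  obtain p where p: "p \<in> W" "p \<notin> U" using maxsing_subset_eq[OF W(1) U] W(2) by auto
  have pp: "p \<in> points \<P>" using sing_points[OF s(2)] p by auto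
  let ?H = "U \<inter> perp {p}"
  note H = perp_hyperplane[OF U pp p(2)]
  let ?U = "cl (insert p ?H)"
  have U': "maxsing ?U" using maxsing_span[OF H] p by simp
  have sup: "insert p ?H \<subseteq> ?U" by (rule pl_span_superset)
  have "U \<inter> ?U = ?H" using maxsing_Int[OF U U' _ H(1) _ _ H(2)] sup p by auto
  then have "Suc (rk (U \<inter> ?U)) = n" using H(2) by simp
  moreover have UW: "U \<inter> W \<subseteq> ?U" using sup sing_perp[OF s(2), of "{p}"] p(1) by auto
  moreover have "rk (U \<inter> W) < rk (?U \<inter> W)"
    by (rule rk_less[OF sing_Int'[OF s] sing_Int'[OF maxsing_sing[OF U'] s(2)], of p])
      (use UW sup p in auto)
  ultimately show ?thesis using that U' by simp
qed

section \<open>Distances, geodesics and cliques\<close>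

lemma grassmannian_maxsing: "S \<in> grassmannian \<P> (int n - 1) \<longleftrightarrow> maxsing S"
  by (simp add: grassmannian_iff maxsing_iff)

lemma dual_polar_edges_iff:
  "(S, T) \<in> dual_polar_edges \<P> n \<longleftrightarrow> maxsing S \<and> maxsing T \<and> Suc (rk (S \<inter> T)) = n"
proof -
  have "S \<inter> T \<in> grassmannian \<P> (int n - 2) \<longleftrightarrow> Suc (rk (S \<inter> T)) = n" if "maxsing S" "maxsing T"
    using that sing_Int'[OF maxsing_sing maxsing_sing, of S T] by (auto simp: grassmannian_iff)
  then show ?thesis by (auto simp: dual_polar_edges_def grassmannian_maxsing)
qed

text \<open>The rank of the intersection with \<open>S\<close> starts at \<open>n\<close> and drops
  by at most one along each edge.\<close>

lemma walk_length_ge: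
  assumes S: "maxsing S" "(S, T) \<in> dual_polar_edges \<P> n ^^ k"
  shows "maxsing T \<and> n \<le> rk (S \<inter> T) + k"
  using S(2)
proof (induction k arbitrary: T)
  case 0
  then show ?case using S(1) by (simp add: maxsing_iff)
next
  case (Suc k)
  then obtain R where R: "(S, R) \<in> dual_polar_edges \<P> n ^^ k" "(R, T) \<in> dual_polar_edges \<P> n"
    by (auto elim: relpow_Suc_E)
  have IH: "maxsing R" "n \<le> rk (S \<inter> R) + k" using Suc(1)[OF R(1)] by simp_all
  have RT: "maxsing T" "Suc (rk (R \<inter> T)) = n" using R(2) by (simp_all add: dual_polar_edges_iff)
  have s: "sing S" "sing R" "sing T" using S(1) IH RT by (simp_all add: maxsing_sing)
  have "rk (S \<inter> R) \<le> Suc (rk (S \<inter> R \<inter> (R \<inter> T)))"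
    using rk_Int_hyperplane[OF s(2) sing_Int'[OF s(2,3)] _ _ sing_Int'[OF s(1,2)]] RT IH(1)
    by (simp add: maxsing_iff)
  also have "rk (S \<inter> R \<inter> (R \<inter> T)) \<le> rk (S \<inter> T)"
    by (rule rk_mono) (use s in \<open>auto intro!: sing_Int'\<close>)
  finally show ?case using IH RT(1) by simp
qed

lemma walk_exists:
  assumes "maxsing S" "maxsing T"
  shows "\<exists>k \<le> n - rk (S \<inter> T). (S, T) \<in> dual_polar_edges \<P> n ^^ k"
  using assms(1)
proof (induction "n - rk (S \<inter> T)" arbitrary: S rule: less_induct)
  case less
  show ?case
  proof (cases "S = T")
    case True then show ?thesis by (intro exI[of _ 0]) simp
  next
    case False
    obtain U where U: "maxsing U" "Suc (rk (S \<inter> U)) = n" "rk (S \<inter> T) < rk (U \<inter> T)"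
      using step_towards[OF less(2) assms(2) False] .
    have "rk (U \<inter> T) \<le> n" using U assms(2) by (intro rk_le sing_Int' maxsing_sing)
    then have lt: "n - rk (U \<inter> T) < n - rk (S \<inter> T)" using U(3) by simp
    then obtain k where k: "k \<le> n - rk (U \<inter> T)" "(U, T) \<in> dual_polar_edges \<P> n ^^ k"
      using less(1)[OF _ U(1)] by auto
    moreover have "(S, U) \<in> dual_polar_edges \<P> n" using U less(2) by (simp add: dual_polar_edges_iff)
    ultimately have "(S, T) \<in> dual_polar_edges \<P> n ^^ Suc k" by (intro relpow_Suc_I2)
    then show ?thesis using k(1) lt by (intro exI[of _ "Suc k"]) simp
  qed
qed

lemma graph_dist_dual_polar:
  assumes "maxsing S" "maxsing T"
  shows "graph_dist (dual_polar_edges \<P> n) S T = enat (n - rk (S \<inter> T))"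
proof -
  obtain k where k: "k \<le> n - rk (S \<inter> T)" "(S, T) \<in> dual_polar_edges \<P> n ^^ k"
    using walk_exists[OF assms] by auto
  have ge: "n - rk (S \<inter> T) \<le> j" if "(S, T) \<in> dual_polar_edges \<P> n ^^ j" for j
    using walk_length_ge[OF assms(1) that] by (simp add: le_diff_conv add.commute)
  show ?thesis
    unfolding graph_dist_def
  proof (rule antisym)
    have "(INF k\<in>{k. (S, T) \<in> dual_polar_edges \<P> n ^^ k}. enat k) \<le> enat k"
      using k by (intro INF_lower) simp
    then show "(INF k\<in>{k. (S, T) \<in> dual_polar_edges \<P> n ^^ k}. enat k) \<le> enat (n - rk (S \<inter> T))"
      using k(1) by (meson enat_ord_simps(1) order_trans)
    show "enat (n - rk (S \<inter> T)) \<le> (INF k\<in>{k. (S, T) \<in> dual_polar_edges \<P> n ^^ k}. enat k)"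
      using ge by (intro INF_greatest) simp
  qed
qed

text \<open>In terms of distances, the rank hypothesis says that \<open>U\<close> lies on a geodesic
  from \<open>X\<close> to \<open>Y\<close>. By \<open>rk_modular\<close> inside \<open>U\<close>,
  the triple intersection then has at least the rank of \<open>X \<inter> Y\<close>.\<close>

lemma Int_subset_geodesic:
  assumes X: "maxsing X" and Y: "maxsing Y" and U: "maxsing U"
    and le: "n + rk (X \<inter> Y) \<le> rk (X \<inter> U) + rk (U \<inter> Y)"
  shows "X \<inter> Y \<subseteq> U"
proof -
  have s: "sing X" "sing Y" "sing U" using X Y U by (simp_all add: maxsing_sing)
  have "rk (X \<inter> U) + rk (U \<inter> Y) \<le> n + rk (X \<inter> U \<inter> (U \<inter> Y))"
    using rk_modular[OF s(3) sing_Int'[OF s(1,3)] _ sing_Int'[OF s(3,2)]] U by (simp add: maxsing_iff)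
  then have "rk (X \<inter> Y) \<le> rk (X \<inter> U \<inter> (U \<inter> Y))" using le by simp
  then have "X \<inter> U \<inter> (U \<inter> Y) = X \<inter> Y"
    using s by (intro rk_eq sing_Int') auto
  then show ?thesis by auto
qed

text \<open>A point \<open>x\<close> of \<open>A \<inter> B\<close> outside \<open>C\<close> would
  make \<open>A \<inter> C\<close> and \<open>B \<inter> C\<close> both equal to
  \<open>C \<inter> perp {x}\<close>; then \<open>A \<inter> C\<close> lies in
  \<open>A \<inter> B\<close>, and equal ranks force equality.\<close>

lemma triangle_Int:
  assumes A: "maxsing A" and B: "maxsing B" and C: "maxsing C"
    and r: "Suc (rk (A \<inter> B)) = n" "Suc (rk (A \<inter> C)) = n" "Suc (rk (B \<inter> C)) = n"
  shows "A \<inter> B \<subseteq> C"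
proof (rule ccontr)
  assume "\<not> A \<inter> B \<subseteq> C"
  then obtain x where x: "x \<in> A" "x \<in> B" "x \<notin> C" by auto
  have s: "sing A" "sing B" "sing C" using A B C by (simp_all add: maxsing_sing)
  have xA: "x \<in> perp (A \<inter> C)" using sing_perp[OF s(1), of "A \<inter> C"] x(1) by auto
  have xB: "x \<in> perp (B \<inter> C)" using sing_perp[OF s(2), of "B \<inter> C"] x(2) by auto
  have "A \<inter> C = C \<inter> perp {x}"
    using hyperplane_eq_perp[OF C sing_Int'[OF s(1,3)] Int_lower2 r(2) xA x(3)] .
  moreover have "B \<inter> C = C \<inter> perp {x}"
    using hyperplane_eq_perp[OF C sing_Int'[OF s(2,3)] Int_lower2 r(3) xB x(3)] .
  ultimately have "A \<inter> C \<subseteq> A \<inter> B" by auto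
  then have "A \<inter> C = A \<inter> B" using r s by (intro rk_eq sing_Int') auto
  then show False using x by auto
qed

end

section \<open>Isometric embeddings\<close>

locale dual_polar_embedding =
  A: ranked_polar_space \<P> n + B: ranked_polar_space \<P>' n'
  for \<P> :: "'a point_line" and n :: nat and \<P>' :: "'b point_line" and n' :: nat +
  fixes f :: "'a set \<Rightarrow> 'b set"
  assumes le: "n \<le> n'"
    and isometric: "isometric_embedding
           (grassmannian \<P> (int n - 1)) (dual_polar_edges \<P> n)
           (grassmannian \<P>' (int n' - 1)) (dual_polar_edges \<P>' n') f"
begin

lemma maxsing_image: "A.maxsing S \<Longrightarrow> B.maxsing (f S)"
  using isometric
  by (auto simp: isometric_embedding_def A.grassmannian_maxsing B.grassmannian_maxsing)

text \<open>Equality of distances in additive form; the bounds \<open>n\<close> and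
  \<open>n'\<close> on the ranks undo the truncated subtraction.\<close>

lemma rk_Int_image:
  assumes "A.maxsing S" "A.maxsing T"
  shows "B.rk (f S \<inter> f T) + n = n' + A.rk (S \<inter> T)"
proof -
  have "graph_dist (dual_polar_edges \<P>' n') (f S) (f T) = graph_dist (dual_polar_edges \<P> n) S T"
    using isometric assms by (simp add: isometric_embedding_def A.grassmannian_maxsing)
  then have "n' - B.rk (f S \<inter> f T) = n - A.rk (S \<inter> T)"
    using assms by (simp add: A.graph_dist_dual_polar B.graph_dist_dual_polar maxsing_image)
  moreover have "A.rk (S \<inter> T) \<le> n"
    using assms by (intro A.rk_le A.sing_Int' A.maxsing_sing)
  moreover have "B.rk (f S \<inter> f T) \<le> n'"
    using assms by (intro B.rk_le B.sing_Int' B.maxsing_sing maxsing_image)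
  ultimately show ?thesis using le by linarith
qed

text \<open>Distinct maximal singular subspaces on \<open>H\<close> have adjacent images, so
  \<open>triangle_Int\<close> applies to any three of them.\<close>

lemma image_contains_line:
  assumes H: "A.sing H" "Suc (A.rk H) = n"
    and U: "A.maxsing U" "H \<subseteq> U" "N \<subseteq> f U" and V: "A.maxsing V" "H \<subseteq> V" "N \<subseteq> f V"
    and W: "A.maxsing W" "H \<subseteq> W" and ne: "U \<noteq> V"
  shows "N \<subseteq> f W"
proof (cases "W = U \<or> W = V")
  case True then show ?thesis using U V by auto
next
  case False
  have adj: "Suc (B.rk (f X \<inter> f Y)) = n'"
    if "A.maxsing X" "A.maxsing Y" "H \<subseteq> X" "H \<subseteq> Y" "X \<noteq> Y" for X Y
    using rk_Int_image[OF that(1,2)] A.maxsing_Int[OF that(1,2,5) H(1) that(3,4) H(2)] H(2) by simp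
  have "f U \<inter> f V \<subseteq> f W"
    using B.triangle_Int[OF maxsing_image[OF U(1)] maxsing_image[OF V(1)] maxsing_image[OF W(1)]]
      adj[of U V] adj[of U W] adj[of V W] U V W ne False by auto
  then show ?thesis using U V by auto
qed

text \<open>The gate \<open>W\<close> towards \<open>V\<close> on the line through \<open>U\<close>
  and \<open>U'\<close> lies on a geodesic from \<open>U\<close> to \<open>V\<close>, so
  \<open>f W\<close> contains \<open>N\<close>. As \<open>W\<close> differs from \<open>U\<close>,
  two members of the line have this property, and \<open>U'\<close> inherits it.\<close>

lemma image_contains_neighbour:
  assumes U: "A.maxsing U" "N \<subseteq> f U" and V: "A.maxsing V" "N \<subseteq> f V"
    and U': "A.maxsing U'" "Suc (A.rk (U \<inter> U')) = n" "U \<inter> V \<subseteq> U'"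
  shows "N \<subseteq> f U'"
proof -
  let ?H = "U \<inter> U'"
  have s: "A.sing U" "A.sing V" "A.sing U'" using U V U' by (simp_all add: A.maxsing_sing)
  have sH: "A.sing ?H" using A.sing_Int'[OF s(1,3)] .
  obtain W y where W: "A.maxsing W" "?H \<subseteq> W" "y \<in> W" "y \<in> V" "y \<notin> ?H"
    using A.gate_exists[OF V(1) sH U'(2)] .
  have sW: "A.sing W" using A.maxsing_sing[OF W(1)] .
  have UW: "U \<noteq> W" using W U' by auto
  have "A.rk ?H \<le> A.rk (U \<inter> W)" using W by (intro A.rk_mono[OF sH A.sing_Int'[OF s(1) sW]]) auto
  moreover have "A.rk (U \<inter> V) < A.rk (W \<inter> V)"
    by (rule A.rk_less[OF A.sing_Int'[OF s(1,2)] A.sing_Int'[OF sW s(2)], of y]) (use W U' in auto)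
  ultimately have "n' + B.rk (f U \<inter> f V) \<le> B.rk (f U \<inter> f W) + B.rk (f W \<inter> f V)"
    using rk_Int_image[OF U(1) V(1)] rk_Int_image[OF U(1) W(1)] rk_Int_image[OF W(1) V(1)] U'(2)
    by linarith
  then have "f U \<inter> f V \<subseteq> f W"
    using B.Int_subset_geodesic[OF maxsing_image[OF U(1)] maxsing_image[OF V(1)] maxsing_image[OF W(1)]]
    by simp
  then have "N \<subseteq> f W" using U V by auto
  then show ?thesis
    using image_contains_line[OF sH U'(2) U(1) _ U(2) W(1,2) _ U'(1) _ UW] by auto
qed

text \<open>A step from \<open>U\<close> to \<open>U'\<close> may destroy oppositeness to \<open>V\<close> relative to \<open>U \<inter> V\<close>; it is restored by
  replacing \<open>V\<close> with a neighbour.\<close>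

lemma opposite_neighbour:
  assumes U: "A.maxsing U" "N \<subseteq> f U" and V: "A.maxsing V" "N \<subseteq> f V"
    and U': "A.maxsing U'" "Suc (A.rk (U \<inter> U')) = n" "U \<inter> V \<subseteq> U'"
  obtains W where "A.maxsing W" "N \<subseteq> f W" "U' \<inter> W = U \<inter> V"
proof (cases "U' \<inter> V \<subseteq> U")
  case True
  then show ?thesis using that[OF V] U' by auto
next
  case False
  let ?K = "U \<inter> V"
  obtain y where y: "y \<in> U'" "y \<in> V" "y \<notin> ?K" using False by auto
  have s: "A.sing U" "A.sing V" "A.sing U'" using U V U' by (simp_all add: A.maxsing_sing)
  have sK: "A.sing ?K" using A.sing_Int'[OF s(1,2)] .
  obtain H where H: "A.sing H" "?K \<subseteq> H" "H \<subseteq> V" "y \<notin> H" "A.rk V = Suc (A.rk H)"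
    using A.hyperplane_avoiding[OF s(2) sK Int_lower2 y(2,3)] .
  have rH: "Suc (A.rk H) = n" using H(5) V(1) by (simp add: A.maxsing_iff)
  obtain W where W: "A.maxsing W" "H \<subseteq> W" "W \<noteq> V" using A.other_maxsing[OF V(1) H(1,3) rH] .
  have VW: "V \<inter> W = H" using A.maxsing_Int[OF V(1) W(1) _ H(1,3) W(2) rH] W(3) by auto
  \<comment> \<open>The roles are exchanged here: \<open>V\<close> moves to its neighbour
    \<open>W\<close>, relative to \<open>U\<close>.\<close>
  have "N \<subseteq> f W"
    using image_contains_neighbour[OF V U W(1)] VW rH W(2) H(2) by auto
  moreover have "W \<inter> U' = H \<inter> U'"
    using A.gate_unique[OF V(1) H(3) y(2) W(1,2) _ U'(1) y(1) H(1) rH H(4)] W(3) by auto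
  \<comment> \<open>The rank of \<open>U' \<inter> V\<close> exceeds that of \<open>?K\<close> by at
    most one, and \<open>H\<close> omits its point \<open>y\<close>, so nothing beyond
    \<open>?K\<close> is left.\<close>
  moreover have "H \<inter> U' = ?K"
  proof -
    have sHU: "A.sing (H \<inter> U')" using A.sing_Int'[OF H(1) s(3)] .
    have "A.rk (U' \<inter> V) \<le> Suc (A.rk (U' \<inter> V \<inter> (U \<inter> U')))"
      using A.rk_Int_hyperplane[OF s(3) A.sing_Int'[OF s(1,3)] Int_lower2 _ A.sing_Int'[OF s(3,2)]] U'
      by (simp add: A.maxsing_iff)
    moreover have "U' \<inter> V \<inter> (U \<inter> U') = ?K" using U'(3) by auto
    moreover have "A.rk (H \<inter> U') < A.rk (U' \<inter> V)"
      by (rule A.rk_less[OF sHU A.sing_Int'[OF s(3,2)], of y]) (use y H in auto)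
    ultimately have "A.rk (H \<inter> U') \<le> A.rk ?K" by simp
    then show ?thesis using A.rk_eq[OF sK sHU] H(2) U'(3) by auto
  qed
  ultimately show ?thesis using that[OF W(1)] by (simp add: Int_commute)
qed

text \<open>\<open>U\<close> and \<open>V\<close> both move while \<open>U \<inter> V\<close> stays
  fixed: \<open>U\<close> steps towards \<open>W\<close>, and \<open>opposite_neighbour\<close>
  adjusts \<open>V\<close>. The induction ends at \<open>U = W\<close>; it is applied with
  \<open>N = f S \<inter> f T\<close>.\<close>

lemma Int_image_subset:
  assumes "A.maxsing S" "A.maxsing T" and W: "A.maxsing W" "S \<inter> T \<subseteq> W"
  shows "f S \<inter> f T \<subseteq> f W"
proof -
  have "N \<subseteq> f W" if "A.maxsing U" "N \<subseteq> f U" "A.maxsing V" "N \<subseteq> f V" "U \<inter> V \<subseteq> W" for N U V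
    using that
  proof (induction "n - A.rk (U \<inter> W)" arbitrary: U V rule: less_induct)
    case less
    show ?case
    proof (cases "U = W")
      case True then show ?thesis using less by simp
    next
      case False
      obtain U' where U': "A.maxsing U'" "Suc (A.rk (U \<inter> U')) = n" "U \<inter> W \<subseteq> U'"
          "A.rk (U \<inter> W) < A.rk (U' \<inter> W)"
        using A.step_towards[OF less(2) W(1) False] .
      have UV: "U \<inter> V \<subseteq> U'" using U'(3) less(6) by auto
      have N: "N \<subseteq> f U'" using image_contains_neighbour[OF less(2-5) U'(1,2) UV] .
      obtain V' where V': "A.maxsing V'" "N \<subseteq> f V'" "U' \<inter> V' = U \<inter> V"
        using opposite_neighbour[OF less(2-5) U'(1,2) UV] .
      have "A.rk (U' \<inter> W) \<le> n" using U' W by (intro A.rk_le A.sing_Int' A.maxsing_sing)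
      then have "n - A.rk (U' \<inter> W) < n - A.rk (U \<inter> W)" using U'(4) by simp
      then show ?thesis using less(1)[OF _ U'(1) N V'(1,2)] V'(3) less(6) by simp
    qed
  qed
  then show ?thesis using assms by (meson Int_lower1 Int_lower2)
qed

section \<open>The subspaces \<open>core K\<close>\<close>

definition core :: "'a set \<Rightarrow> 'b set" where
  "core K = \<Inter> {f U | U. A.maxsing U \<and> K \<subseteq> U}"

lemma core_subset: "A.maxsing U \<Longrightarrow> K \<subseteq> U \<Longrightarrow> core K \<subseteq> f U"
  by (auto simp: core_def)

lemma core_mono: "K \<subseteq> L \<Longrightarrow> core K \<subseteq> core L"
  unfolding core_def by (intro Inter_anti_mono) auto

lemma core_Int:
  assumes "A.maxsing S" "A.maxsing T" shows "core (S \<inter> T) = f S \<inter> f T"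
proof
  show "core (S \<inter> T) \<subseteq> f S \<inter> f T" using core_subset[of _ "S \<inter> T"] assms by simp
  show "f S \<inter> f T \<subseteq> core (S \<inter> T)"
  proof
    fix x assume x: "x \<in> f S \<inter> f T"
    have "x \<in> f W" if "A.maxsing W" "S \<inter> T \<subseteq> W" for W
      using Int_image_subset[OF assms that] x by auto
    then show "x \<in> core (S \<inter> T)" by (auto simp: core_def)
  qed
qed

lemma core_maxsing: "A.maxsing S \<Longrightarrow> core S = f S"
  using core_Int[of S S] by simp

text \<open>A maximal \<open>S\<close> on \<open>K\<close> and the \<open>T\<close> from
  \<open>complement_exists\<close> meet exactly in \<open>K\<close>, so \<open>core K\<close> is an
  intersection of two images, whose rank is known.\<close>

lemma core_sing:
  assumes "A.sing K" shows "B.sing (core K)" "B.rk (core K) + n = n' + A.rk K"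
proof -
  obtain S where S: "A.maxsing S" "K \<subseteq> S" using A.sing_in_maxsing[OF assms] .
  obtain T where T: "A.maxsing T" "K \<subseteq> T" "T \<inter> S = K \<inter> S" using A.complement_exists[OF S(1) assms] .
  have K: "T \<inter> S = K" using T S by auto
  have "core K = f T \<inter> f S" using core_Int[OF T(1) S(1)] K by simp
  moreover have "B.sing (f T \<inter> f S)" using S T by (intro B.sing_Int' B.maxsing_sing maxsing_image)
  ultimately show "B.sing (core K)" "B.rk (core K) + n = n' + A.rk K"
    using rk_Int_image[OF T(1) S(1)] K by simp_all
qed

text \<open>\<open>L\<close> and \<open>p\<close> lie in disjoint maximal singular subspaces
  \<open>U\<close> and \<open>V\<close>, so \<open>core {p}\<close> and \<open>core L\<close> meet
  inside \<open>core {}\<close>, whose rank is smaller than that of \<open>core {p}\<close>.\<close>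

lemma core_point_not_subset:
  assumes L: "A.sing L" and p: "p \<in> A.perp L" "p \<notin> L"
  obtains z where "z \<in> core {p}" "z \<notin> core L"
proof -
  have pp: "p \<in> points \<P>" using p by (simp add: A.perp_def)
  have sp: "A.sing {p}" using A.sing_singleton[OF pp] .
  obtain S where S: "A.maxsing S" "A.cl (insert p L) \<subseteq> S"
    using A.sing_in_maxsing[OF A.sing_span_insert[OF L p(1)]] .
  have pS: "insert p L \<subseteq> S" using S(2) pl_span_superset[of "insert p L" \<P>] by auto
  obtain U where U: "A.maxsing U" "L \<subseteq> U" "U \<inter> S = L \<inter> S" using A.complement_exists[OF S(1) L] .
  have pU: "p \<notin> U" using U p pS by auto
  obtain V where V: "A.maxsing V" "{p} \<subseteq> V" "V \<inter> U = {p} \<inter> U" using A.complement_exists[OF U(1) sp] .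
  have "V \<inter> U = {}" using V pU by auto
  then have "f V \<inter> f U = core {}" using core_Int[OF V(1) U(1)] by simp
  then have sub: "core {p} \<inter> core L \<subseteq> core {}" using core_subset[OF V(1,2)] core_subset[OF U(1,2)] by auto
  have "\<not> core {p} \<subseteq> core L"
  proof
    assume "core {p} \<subseteq> core L"
    then have "core {p} \<subseteq> core {}" using sub by auto
    then have "B.rk (core {p}) \<le> B.rk (core {})"
      by (rule B.rk_mono[OF core_sing(1)[OF sp] core_sing(1)[OF A.sing_empty]])
    then show False
      using core_sing(2)[OF sp] core_sing(2)[OF A.sing_empty] A.rk_empty A.rk_singleton[OF pp] by simp
  qed
  then show ?thesis using that by auto
qed

lemma core_hyperplane_span:
  assumes X: "A.sing X" and L: "A.sing L" "L \<subseteq> X" "A.rk X = Suc (A.rk L)" and p: "p \<in> X"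
    and z: "z \<in> core {p}" "z \<notin> core L"
  shows "B.cl (insert z (core L)) = core X"
proof (rule B.hyperplane_span)
  show "B.sing (core X)" "B.sing (core L)" using core_sing X L by simp_all
  show "core L \<subseteq> core X" using core_mono[OF L(2)] .
  show "B.rk (core X) \<le> Suc (B.rk (core L))" using core_sing(2)[OF X] core_sing(2)[OF L(1)] L(3) by simp
  show "z \<in> core X" using core_mono[of "{p}" X] p z by auto
  show "z \<notin> core L" by (rule z)
qed

text \<open>Since \<open>core\<close> shifts ranks by a constant, \<open>core L\<close> is spanned
  by the core of a hyperplane of \<open>L\<close> and one more point, found in
  \<open>core {p}\<close> for a \<open>p\<close> off that hyperplane. The term
  \<open>core {}\<close> covers the empty \<open>L\<close>.\<close>

lemma core_span:
  assumes "A.sing L" shows "core L = B.cl (core {} \<union> (\<Union>p\<in>L. core {p}))"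
  using assms
proof (induction "A.rk L" arbitrary: L rule: less_induct)
  case less
  let ?Z = "\<lambda>L. core {} \<union> (\<Union>p\<in>L. core {p})"
  have ZL: "?Z L \<subseteq> core L" using core_mono[of _ L] by auto
  have subL: "pl_subspace \<P>' (core L)" using B.sing_subspace[OF core_sing(1)[OF less(2)]] .
  show ?case
  proof
    show "B.cl (?Z L) \<subseteq> core L" using pl_span_least[OF subL ZL] .
    show "core L \<subseteq> B.cl (?Z L)"
    proof (cases "L = {}")
      case True then show ?thesis using pl_span_superset[of "?Z L" \<P>'] by auto
    next
      case False
      then obtain p where p: "p \<in> L" by auto
      obtain H where H: "A.sing H" "H \<subseteq> L" "p \<notin> H" "A.rk L = Suc (A.rk H)"
        using A.hyperplane_avoiding[OF less(2) A.sing_empty _ p] by auto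
      have "p \<in> A.perp H" using A.sing_perp[OF less(2) H(2)] p by auto
      then obtain z where z: "z \<in> core {p}" "z \<notin> core H" using core_point_not_subset[OF H(1) _ H(3)] by auto
      have "core H = B.cl (?Z H)" using less(1)[OF _ H(1)] H(4) by simp
      moreover have "B.cl (?Z H) \<subseteq> B.cl (?Z L)" using H(2) by (intro pl_span_mono) auto
      moreover have "z \<in> B.cl (?Z L)" using z p pl_span_superset[of "?Z L" \<P>'] by auto
      ultimately have "insert z (core H) \<subseteq> B.cl (?Z L)" by auto
      moreover have "pl_subspace \<P>' (B.cl (?Z L))"
        using ZL B.sing_points[OF core_sing(1)[OF less(2)]] by (intro B.subspace_span) auto
      ultimately have "B.cl (insert z (core H)) \<subseteq> B.cl (?Z L)" using pl_span_least by metis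
      then show ?thesis using core_hyperplane_span[OF less(2) H(1,2,4) p z] by simp
    qed
  qed
qed

lemma image_eq_span:
  assumes "A.maxsing S" shows "f S = B.cl (\<Union>p\<in>S. core {p})"
proof -
  have "A.rk S \<noteq> 0" using assms A.rank by (simp add: A.maxsing_iff polar_space_of_rank_def)
  then obtain p where "p \<in> S" using A.rk_empty by fastforce
  then have "core {} \<union> (\<Union>p\<in>S. core {p}) = (\<Union>p\<in>S. core {p})"
    using core_mono[of "{}"] by auto
  then show ?thesis using core_span[OF A.maxsing_sing[OF assms]] core_maxsing[OF assms] by simp
qed

text \<open>With \<open>S\<close> on \<open>p\<close>, \<open>?L\<close> its hyperplane collinear
  with \<open>q\<close>, and \<open>?T\<close> the span of \<open>q\<close> and \<open>?L\<close>,
  choose \<open>z\<close> in \<open>core {p}\<close> and \<open>w\<close> in \<open>core {q}\<close>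
  outside \<open>core ?L\<close>. Being collinear with \<open>z\<close> and \<open>core ?L\<close>,
  which span \<open>f S\<close>, the point \<open>w\<close> lies in
  \<open>f S \<inter> f ?T = core ?L\<close>.\<close>

lemma core_noncollinear:
  assumes p: "p \<in> points \<P>" and q: "q \<in> points \<P>" and pq: "\<not> coll \<P> p q"
    and X: "B.sing X" "core {p} \<subseteq> X" "core {q} \<subseteq> X"
  shows False
proof -
  obtain S where S: "A.maxsing S" "{p} \<subseteq> S" using A.sing_in_maxsing[OF A.sing_singleton[OF p]] .
  have sS: "A.sing S" "A.rk S = n" using S by (simp_all add: A.maxsing_iff)
  have pS: "p \<in> S" using S by simp
  have qS: "q \<notin> S" using A.sing_coll[OF sS(1) pS, of q] pq by auto
  let ?L = "S \<inter> A.perp {q}"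
  note L = A.perp_hyperplane[OF S(1) q qS]
  have pL: "p \<notin> ?L" using pq by (simp add: A.perp_def)
  have qL: "q \<notin> ?L" using qS by simp
  have pL': "p \<in> A.perp ?L" using A.sing_perp[OF sS(1), of ?L] pS by auto
  let ?T = "A.cl (insert q ?L)"
  have T: "A.maxsing ?T" using A.maxsing_span[OF L qL] .
  have sup: "insert q ?L \<subseteq> ?T" by (rule pl_span_superset)
  have "S \<inter> ?T = ?L" using A.maxsing_Int[OF S(1) T _ L(1) _ _ L(2)] sup qS by auto
  then have ST: "f S \<inter> f ?T = core ?L" using core_Int[OF S(1) T] by simp
  obtain z where z: "z \<in> core {p}" "z \<notin> core ?L" using core_point_not_subset[OF L(1) pL' pL] .
  obtain w where w: "w \<in> core {q}" "w \<notin> core ?L" using core_point_not_subset[OF L(1,3) qL] .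
  have "B.cl (insert z (core ?L)) = core S"
    using core_hyperplane_span[OF sS(1) L(1) Int_lower1 _ pS z] L(2) sS(2) by simp
  then have span: "B.cl (insert z (core ?L)) = f S" using core_maxsing[OF S(1)] by simp
  have wT: "w \<in> f ?T" using core_subset[OF T, of "{q}"] sup w(1) by auto
  have "core ?L \<subseteq> f ?T" using ST by auto
  then have "w \<in> B.perp (core ?L)"
    using B.sing_perp[OF B.maxsing_sing[OF maxsing_image[OF T]]] wT by auto
  moreover have "coll \<P>' w z" using B.sing_coll[OF X(1), of w z] X w z by auto
  ultimately have "w \<in> B.perp (insert z (core ?L))" by (simp add: B.perp_def)
  moreover have "insert z (core ?L) \<subseteq> points \<P>'"
    using span pl_span_superset[of "insert z (core ?L)" \<P>'] B.sing_points[OF B.maxsing_sing[OF maxsing_image[OF S(1)]]]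
    by auto
  ultimately have "w \<in> B.perp (f S)" using B.perp_span span by metis
  then have "w \<in> f S" by (rule B.maxsing_perp[OF maxsing_image[OF S(1)]])
  then show False using ST wT w by auto
qed

section \<open>The induced map into the residue of \<open>core {}\<close>\<close>

abbreviation "residue \<equiv> star_polar_space \<P>' (core {}) (int n' - int n)"

lemma core_in_residue:
  assumes "p \<in> points \<P>" shows "core {p} \<in> points residue"
proof -
  have s: "A.sing {p}" using A.sing_singleton[OF assms] .
  have "int (B.rk (core {p})) = int n' - int n + 1"
    using core_sing(2)[OF s] A.rk_singleton[OF assms] by simp
  then have "core {p} \<in> grassmannian \<P>' (int n' - int n)"
    using core_sing(1)[OF s] by (simp add: B.grassmannian_iff)
  then show ?thesis using core_mono[of "{}" "{p}"] by (simp add: star_polar_space_def star_over_def)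
qed

text \<open>A line of the residue comes from a singular subspace containing all its elements, which
  \<open>core_noncollinear\<close> excludes for non-collinear points. Conversely, the core of the
  line joining \<open>p\<close> and \<open>q\<close> yields a line of the residue.\<close>

lemma coll_residue_iff:
  assumes p: "p \<in> points \<P>" and q: "q \<in> points \<P>"
  shows "coll residue (core {p}) (core {q}) \<longleftrightarrow> coll \<P> p q"
proof
  assume c: "coll residue (core {p}) (core {q})"
  have "\<exists>X. B.sing X \<and> core {p} \<subseteq> X \<and> core {q} \<subseteq> X"
  proof (cases "core {p} = core {q}")
    case True
    then show ?thesis using core_sing(1)[OF A.sing_singleton[OF p]] by (intro exI[of _ "core {p}"]) simp
  next
    case False
    then obtain l where "l \<in> lines residue" "core {p} \<in> l" "core {q} \<in> l"
      using c by (auto simp: coll_def)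
    then show ?thesis by (auto simp: star_polar_space_def star_over_def B.grassmannian_iff)
  qed
  then show "coll \<P> p q" using core_noncollinear[OF p q] by auto
next
  assume c: "coll \<P> p q"
  show "coll residue (core {p}) (core {q})"
  proof (cases "p = q")
    case True
    then show ?thesis using core_in_residue[OF p] by (simp add: coll_def)
  next
    case False
    have qp: "q \<in> A.perp {p}" using A.coll_sym[OF c] q by (simp add: A.perp_def)
    let ?l = "A.cl (insert q {p})"
    have s: "A.sing ?l" using A.sing_span_insert[OF A.sing_singleton[OF p] qp] .
    have "A.rk ?l = 2" using A.rk_insert[OF A.sing_singleton[OF p] qp] A.rk_singleton[OF p] False by simp
    then have "int (B.rk (core ?l)) = int n' - int n + 1 + 1" using core_sing(2)[OF s] by simp
    then have U: "core ?l \<in> star_over \<P>' (core {}) (int n' - int n + 1)"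
      using core_sing(1)[OF s] core_mono[of "{}" ?l] by (simp add: B.grassmannian_iff star_over_def)
    let ?m = "{X \<in> star_over \<P>' (core {}) (int n' - int n). X \<subseteq> core ?l}"
    have "?m \<in> lines residue" using U by (auto simp: star_polar_space_def)
    moreover have "insert q {p} \<subseteq> ?l" by (rule pl_span_superset)
    then have "core {p} \<subseteq> core ?l" "core {q} \<subseteq> core ?l" by (simp_all add: core_mono)
    then have "core {p} \<in> ?m" "core {q} \<in> ?m"
      using core_in_residue[OF p] core_in_residue[OF q] by (simp_all add: star_polar_space_def)
    ultimately have "\<exists>l\<in>lines residue. core {p} \<in> l \<and> core {q} \<in> l" by (intro bexI[of _ ?m] conjI)
    then show ?thesis
      using core_in_residue[OF p] core_in_residue[OF q] by (simp add: coll_def)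
  qed
qed

lemma core_frames_preserving: "frames_preserving n \<P> residue (\<lambda>p. core {p})"
  unfolding frames_preserving_def
proof (intro conjI allI impI)
  show "(\<lambda>p. core {p}) \<in> points \<P> \<rightarrow> points residue" using core_in_residue by simp
  fix F assume F: "polar_frame \<P> n F"
  let ?g = "\<lambda>p. core {p}"
  have Fp: "p \<in> points \<P>" if "p \<in> F" for p using F that by (auto simp: polar_frame_def)
  have opp: "\<exists>!q. q \<in> F \<and> \<not> coll \<P> p q" if "p \<in> F" for p
    using F that by (simp add: polar_frame_def)
  \<comment> \<open>Points with equal images have the same opposites: the \<open>q\<close> opposite
    to \<open>p\<close> is also opposite to \<open>p'\<close>, and \<open>q\<close> has only one
    opposite in \<open>F\<close>.\<close>
  have inj: "inj_on ?g F"
  proof (rule inj_onI)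
    fix p p' assume p: "p \<in> F" "p' \<in> F" "core {p} = core {p'}"
    obtain q where q: "q \<in> F" "\<not> coll \<P> p q" using opp[OF p(1)] by auto
    have "\<not> coll \<P> p' q"
      using q p coll_residue_iff[OF Fp Fp, of p q] coll_residue_iff[OF Fp Fp, of p' q] by simp
    then have "\<not> coll \<P> q p'" "\<not> coll \<P> q p" using q A.coll_commute by simp_all
    then show "p = p'" using opp[OF q(1)] p by auto
  qed
  show "polar_frame residue n (?g ` F)"
    unfolding polar_frame_def
  proof (intro conjI ballI)
    show "?g ` F \<subseteq> points residue" using core_in_residue Fp by auto
    show "finite (?g ` F)" "card (?g ` F) = 2 * n"
      using F card_image[OF inj] by (simp_all add: polar_frame_def)
    fix P assume "P \<in> ?g ` F"
    then obtain p where p: "p \<in> F" "P = core {p}" by auto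
    obtain q where q: "q \<in> F" "\<not> coll \<P> p q" using opp[OF p(1)] by auto
    have uniq: "r = q" if "r \<in> F" "\<not> coll \<P> p r" for r using opp[OF p(1)] q that by auto
    show "\<exists>!Q. Q \<in> ?g ` F \<and> \<not> coll residue P Q"
    proof (rule ex1I[of _ "core {q}"])
      show "core {q} \<in> ?g ` F \<and> \<not> coll residue P (core {q})"
        using p q coll_residue_iff[OF Fp Fp, of p q] by auto
      fix Q assume "Q \<in> ?g ` F \<and> \<not> coll residue P Q"
      then obtain r where "r \<in> F" "Q = core {r}" "\<not> coll residue P (core {r})" by auto
      then show "Q = core {q}" using p uniq[of r] coll_residue_iff[OF Fp Fp, of p r] by simp
    qed
  qed
qed

end

theorem theorem3:
  fixes \<P> :: "'a point_line" and \<P>' :: "'b point_line"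
    and n n' :: nat and f :: "'a set \<Rightarrow> 'b set"
  assumes "polar_space_of_rank \<P> n"
    and "polar_space_of_rank \<P>' n'"
    and "n \<le> n'"
    and "isometric_embedding
           (grassmannian \<P> (int n - 1)) (dual_polar_edges \<P> n)
           (grassmannian \<P>' (int n' - 1)) (dual_polar_edges \<P>' n') f"
  shows "\<exists>M \<in> grassmannian \<P>' (int n' - int n - 1).
           f ` grassmannian \<P> (int n - 1) \<subseteq> star_over \<P>' M (int n' - 1) \<and>
           (\<exists>g. frames_preserving n \<P> (star_polar_space \<P>' M (int n' - int n)) g \<and>
                (\<forall>S \<in> grassmannian \<P> (int n - 1). f S = pl_span \<P>' (\<Union>p\<in>S. g p)))"
proof -
  interpret dual_polar_embedding \<P> n \<P>' n' f
    using assms by unfold_locales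
  show ?thesis
  proof (intro bexI conjI exI ballI)
    \<comment> \<open>By the rank shift \<open>core {}\<close> has rank \<open>n' - n\<close>, which
      is projective dimension \<open>n' - n - 1\<close>; it is empty when
      \<open>n = n'\<close>.\<close>
    show "core {} \<in> grassmannian \<P>' (int n' - int n - 1)"
      using core_sing[OF A.sing_empty] le by (simp add: B.grassmannian_iff A.rk_empty)
    show "f ` grassmannian \<P> (int n - 1) \<subseteq> star_over \<P>' (core {}) (int n' - 1)"
      using maxsing_image core_subset[of _ "{}"]
      by (simp add: image_subset_iff star_over_def A.grassmannian_maxsing B.grassmannian_maxsing)
    show "frames_preserving n \<P> residue (\<lambda>p. core {p})" by (rule core_frames_preserving)
    fix S assume "S \<in> grassmannian \<P> (int n - 1)"
    then show "f S = pl_span \<P>' (\<Union>p\<in>S. core {p})"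
      using image_eq_span by (simp add: A.grassmannian_maxsing)
  qed
qed

end
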